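(* Let $\alpha\in[0,1)$ and $\varepsilon\in(0,1)$ be fixed constants. There exist constants $\xi=\xi(\alpha,\varepsilon)>0$ and $c=c(\alpha,\varepsilon)>0$ such that for every sequence $b_n\ge 0$ with $b_n=o(\log n)$, with probability $1-o(1)$ as $n\to\infty$ over the random graph $G\sim\mathcal{G}(n,\frac12,k=\lfloor n^\alpha\rfloor)$, the following holds. For every $1$-Lipschitz $h:[n]\to\mathbb{R}$ with $h_0=0$, every inverse temperature $\beta$ with $|\beta|\le b_n$ (i.e. $\beta=o(\log n)$), and every clique $C\in\Omega(G)$ of size at most $\xi\log n$, the Metropolis process $\{X_t\}$ on $G$ with stationary distribution $\pi_\beta$ satisfies $$\Pr\big(\exists\, t\in\mathbb{N},\ t\le n^{c\log n}:\ |X_t|\ge(1+\varepsilon)\log n\,\big|\,X_0=C\big)\le n^{-c\log n}.$$ In particular, the Metropolis process starting from the empty clique requires $n^{\Omega(\log n)}$ steps to reach cliques of size at least $(1+\varepsilon)\log n$, with probability $1-n^{-\Omega(\log n)}$.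
   Context: Conventions: $\log$ is the base-2 logarithm; $[n]=\{0,1,\dots,n\}$. Planted clique model: $\mathcal{G}(n,\frac12,k)$ is the random graph on an $n$-element vertex set $V$ obtained by sampling $\mathcal{G}(n,\frac12)$ (each pair is an edge independently with probability $1/2$), choosing a uniformly random $k$-subset $\mathcal{PC}\subseteq V$ (the planted clique), and adding all edges between vertices of $\mathcal{PC}$. $\Omega(G)$ denotes the set of all cliques of $G$, i.e. vertex subsets (including $\emptyset$) whose vertices are pairwise adjacent. Gibbs measure: for $h:[n]\to\mathbb{R}$, written $h_q=h(q)$, and $\beta\in\mathbb{R}$, $\pi_\beta(C)\propto\exp(\beta h_{|C|})$ for $C\in\Omega(G)$. "$h$ is $1$-Lipschitz" means $|h_q-h_{q'}|\le|q-q'|$ for all $q,q'\in[n]$ with $q,q'\le 2.1\log n$. Metropolis process: the Markov chain $\{X_t\}$ on $\Omega(G)$ which at step $t$ picks $v\in V$ uniformly at random and sets $C'=X_{t-1}\oplus\{v\}$ (symmetric difference). If $C'\in\Omega(G)$, then $X_t=C'$ with probability $\min\{1,\exp(\beta(h_{|C'|}-h_{|X_{t-1}|}))\}$ and $X_t=X_{t-1}$ otherwise. If $C'\notin\Omega(G)$, then $X_t=X_{t-1}$. *)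

theory Defs
  imports "HOL-Probability.Probability" "HOL-Library.Ramsey" "HOL-Library.Landau_Symbols"
begin

text \<open>
  A graph on the vertex set \<^term>\<open>{..<n}\<close> is represented by its edge set, a subset of
  \<^term>\<open>nsets {..<n} 2\<close>.
\<close>

definition gnp_half :: "nat \<Rightarrow> nat set set pmf" where
  "gnp_half n = map_pmf (\<lambda>f. {e \<in> nsets {..<n} 2. f e})
     (Pi_pmf (nsets {..<n} 2) False (\<lambda>_. bernoulli_pmf (1/2)))"

definition planted_clique :: "nat \<Rightarrow> nat \<Rightarrow> nat set set pmf" where
  "planted_clique n k =
     do {
       E \<leftarrow> gnp_half n;
       PC \<leftarrow> pmf_of_set {S. S \<subseteq> {..<n} \<and> card S = k};
       return_pmf (E \<union> nsets PC 2)
     }"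

definition cliques :: "nat \<Rightarrow> nat set set \<Rightarrow> nat set set" where
  "cliques n E = {C. C \<subseteq> {..<n} \<and> clique C E}"

definition one_lipschitz :: "nat \<Rightarrow> (nat \<Rightarrow> real) \<Rightarrow> bool" where
  "one_lipschitz n h \<longleftrightarrow>
     (\<forall>q\<in>{0..n}. \<forall>q'\<in>{0..n}. real q \<le> 2.1 * log 2 (real n) \<and> real q' \<le> 2.1 * log 2 (real n)
        \<longrightarrow> \<bar>h q - h q'\<bar> \<le> \<bar>real q - real q'\<bar>)"

definition gibbs :: "nat \<Rightarrow> nat set set \<Rightarrow> (nat \<Rightarrow> real) \<Rightarrow> real \<Rightarrow> nat set pmf" where
  "gibbs n E h \<beta> = embed_pmf (\<lambda>C. if C \<in> cliques n E
     then exp (\<beta> * h (card C)) / (\<Sum>D\<in>cliques n E. exp (\<beta> * h (card D))) else 0)"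

definition metropolis_step ::
    "nat \<Rightarrow> nat set set \<Rightarrow> (nat \<Rightarrow> real) \<Rightarrow> real \<Rightarrow> nat set \<Rightarrow> nat set pmf" where
  "metropolis_step n E h \<beta> C =
     do {
       v \<leftarrow> pmf_of_set {..<n};
       let C' = sym_diff C {v};
       if C' \<in> cliques n E then
         do {
           accept \<leftarrow> bernoulli_pmf (min 1 (exp (\<beta> * (h (card C') - h (card C)))));
           return_pmf (if accept then C' else C)
         }
       else return_pmf C
     }"

text \<open>
  The law on path space of the time-homogeneous Markov chain with transition kernel \<open>K\<close> started
  in \<open>x\<close>, as the projective limit given by the Ionescu-Tulcea theorem. The state at time \<open>0\<close> is
  \<open>x\<close>, and the state at time \<open>t > 0\<close> is sampled from \<open>K\<close> at the state at time \<open>t - 1\<close>.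
\<close>

definition chain_kernel :: "('a \<Rightarrow> 'a pmf) \<Rightarrow> 'a \<Rightarrow> nat \<Rightarrow> (nat \<Rightarrow> 'a) \<Rightarrow> 'a measure" where
  "chain_kernel K x t \<omega> =
     (if t = 0 then return (count_space UNIV) x else measure_pmf (K (\<omega> (t - 1))))"

definition markov_chain :: "('a \<Rightarrow> 'a pmf) \<Rightarrow> 'a \<Rightarrow> (nat \<Rightarrow> 'a) measure" where
  "markov_chain K x =
     projective_family.lim UNIV
       (Ionescu_Tulcea.CI (chain_kernel K x) (\<lambda>_. count_space UNIV)) (\<lambda>_. count_space UNIV)"

definition metropolis ::
    "nat \<Rightarrow> nat set set \<Rightarrow> (nat \<Rightarrow> real) \<Rightarrow> real \<Rightarrow> nat set \<Rightarrow> (nat \<Rightarrow> nat set) measure" where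
  "metropolis n E h \<beta> C = markov_chain (metropolis_step n E h \<beta>) C"

lemma Ionescu_Tulcea_chain:
  "Ionescu_Tulcea (chain_kernel K x) (\<lambda>_. count_space UNIV)"
proof (rule Ionescu_Tulcea.intro)
  fix t :: nat
  have comp: "(\<lambda>\<omega>. \<omega> (t - 1)) \<in> measurable (Pi\<^sub>M {0..<t} (\<lambda>_. count_space UNIV)) (count_space UNIV)"
    if "t \<noteq> 0"
    using that by (intro measurable_component_singleton) auto
  have k: "(\<lambda>y. measure_pmf (K y)) \<in> measurable (count_space UNIV) (subprob_algebra (count_space UNIV))"
    by (auto simp: space_subprob_algebra intro: measure_pmf.subprob_space_axioms)
  show "chain_kernel K x t \<in> measurable (Pi\<^sub>M {0..<t} (\<lambda>_. count_space UNIV))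
      (subprob_algebra (count_space UNIV))"
  proof (cases "t = 0")
    case True
    have "return (count_space UNIV) x \<in> space (subprob_algebra (count_space UNIV))"
      by (auto simp: space_subprob_algebra subprob_space_return)
    then show ?thesis
      unfolding chain_kernel_def using True by simp
  next
    case False
    show ?thesis
      unfolding chain_kernel_def using False measurable_compose[OF comp[OF False] k] by simp
  qed
next
  fix t :: nat and \<omega> :: "nat \<Rightarrow> 'a"
  show "prob_space (chain_kernel K x t \<omega>)"
    by (auto simp: chain_kernel_def prob_space_return measure_pmf.prob_space_axioms)
qed

lemma sets_markov_chain [measurable_cong]:
  "sets (markov_chain K x) = sets (Pi\<^sub>M UNIV (\<lambda>_. count_space UNIV))"
proof -
  interpret Ionescu_Tulcea "chain_kernel K x" "\<lambda>_. count_space UNIV"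
    by (rule Ionescu_Tulcea_chain)
  show ?thesis unfolding markov_chain_def by (rule PF.sets_lim)
qed

lemma space_markov_chain [simp]: "space (markov_chain K x) = UNIV"
proof -
  have "space (markov_chain K x) = space (Pi\<^sub>M UNIV (\<lambda>_. count_space UNIV))"
    by (rule sets_eq_imp_space_eq[OF sets_markov_chain])
  then show ?thesis by (simp add: space_PiM)
qed

lemma emeasure_markov_chain:
  "emeasure (markov_chain K x) {\<omega>. \<forall>i\<le>t. \<omega> i = y i} =
     ennreal (of_bool (y 0 = x) * (\<Prod>i<t. pmf (K (y i)) (y (Suc i))))"
proof -
  interpret Ionescu_Tulcea "chain_kernel K x" "\<lambda>_. count_space UNIV"
    by (rule Ionescu_Tulcea_chain)
  let ?A = "\<lambda>t. PiE {0..<t} (\<lambda>i. {y i})"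
  let ?u = "\<lambda>_::nat. undefined :: 'a"
  define q where "q i = (if i = 0 then of_bool (y 0 = x) else pmf (K (y (i - 1))) (y i))" for i
  have A [measurable]: "?A t \<in> sets (Pi\<^sub>M {0..<t} (\<lambda>_. count_space UNIV))" for t
    by (intro sets_PiM_I_finite) auto
  have u [simp]: "?u \<in> space (Pi\<^sub>M {0..<0::nat} (\<lambda>_. count_space UNIV))"
    by (auto simp: space_PiM)
  have step: "emeasure (eP t \<omega>) (?A (Suc t)) = ennreal (q t) * indicator (?A t) \<omega>"
    if \<omega>: "\<omega> \<in> space (Pi\<^sub>M {0..<t} (\<lambda>_. count_space UNIV))" for t \<omega>
  proof -
    have ext: "\<omega> \<in> extensional {0..<t}"
      using \<omega> by (simp add: space_PiM PiE_iff)
    have "fun_upd \<omega> t z \<in> extensional {0..<Suc t}" for z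
      using ext by (simp add: extensional_def)
    then have upd: "fun_upd \<omega> t z \<in> ?A (Suc t) \<longleftrightarrow> \<omega> \<in> ?A t \<and> z = y t" for z
      using ext by (auto simp: PiE_iff less_Suc_eq)
    have "emeasure (eP t \<omega>) (?A (Suc t)) =
        emeasure (chain_kernel K x t \<omega>) (fun_upd \<omega> t -` ?A (Suc t))"
      using emeasure_eP[OF \<omega> A] by simp
    also have "fun_upd \<omega> t -` ?A (Suc t) = (if \<omega> \<in> ?A t then {y t} else {})"
      using upd by (auto simp del: PiE_iff)
    also have "emeasure (chain_kernel K x t \<omega>) \<dots> = ennreal (q t) * indicator (?A t) \<omega>"
      by (auto simp: chain_kernel_def q_def emeasure_pmf_single PiE_iff indicator_def)
    finally show ?thesis .
  qed
  have C_A: "emeasure (C 0 t ?u) (?A t) = (\<Prod>i<t. ennreal (q i))" for t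
  proof (induction t)
    case 0
    then show ?case by (simp add: PiM_empty)
  next
    case (Suc t)
    have sC: "sets (C 0 t ?u) = sets (Pi\<^sub>M {0..<t} (\<lambda>_. count_space UNIV))"
      and spC: "space (C 0 t ?u) = space (Pi\<^sub>M {0..<t} (\<lambda>_. count_space UNIV))"
      using sets_C[OF u, of t] space_C[OF u, of t] by simp_all
    have "emeasure (C 0 (Suc t) ?u) (?A (Suc t)) = (\<integral>\<^sup>+\<omega>. emeasure (eP t \<omega>) (?A (Suc t)) \<partial>C 0 t ?u)"
      using measurable_eP[of t] A[of "Suc t"] prob_space.not_empty[OF prob_space_C[OF u, of t]]
      by (simp, intro emeasure_bind[where N = "Pi\<^sub>M {0..<Suc t} (\<lambda>_. count_space UNIV)"])
         (auto simp: measurable_cong_sets[OF sC refl])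
    also have "\<dots> = (\<integral>\<^sup>+\<omega>. ennreal (q t) * indicator (?A t) \<omega> \<partial>C 0 t ?u)"
      by (intro nn_integral_cong step) (simp add: spC)
    also have "\<dots> = ennreal (q t) * emeasure (C 0 t ?u) (?A t)"
      using A[of t] by (intro nn_integral_cmult_indicator) (simp add: sC)
    finally show ?case using Suc by (simp add: mult.commute)
  qed
  have "{\<omega>. \<forall>i\<le>t. \<omega> i = y i} = PF.emb UNIV {0..<Suc t} (?A (Suc t))"
    by (auto simp: prod_emb_def space_PiM PiE_iff less_Suc_eq_le)
  then have "emeasure (markov_chain K x) {\<omega>. \<forall>i\<le>t. \<omega> i = y i} = CI {0..<Suc t} (?A (Suc t))"
    unfolding markov_chain_def using lim[OF _ A] by simp
  also have "\<dots> = C 0 (Suc t) ?u (?A (Suc t))"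
    using A[of "Suc t"] by (subst emeasure_CI[where n = "Suc t"]) (auto simp del: C.simps)
  also have "\<dots> = (\<Prod>i<Suc t. ennreal (q i))"
    by (rule C_A)
  also have "\<dots> = ennreal (\<Prod>i<Suc t. q i)"
    by (intro prod_ennreal) (simp add: q_def)
  also have "(\<Prod>i<Suc t. q i) = of_bool (y 0 = x) * (\<Prod>i<t. pmf (K (y i)) (y (Suc i)))"
    by (subst prod.lessThan_Suc_shift) (simp add: q_def)
  finally show ?thesis .
qed

lemma prob_space_markov_chain: "prob_space (markov_chain K x)"
proof -
  interpret Ionescu_Tulcea "chain_kernel K x" "\<lambda>_. count_space UNIV"
    by (rule Ionescu_Tulcea_chain)
  let ?S = "Pi\<^sub>M ({}::nat set) (\<lambda>_. count_space (UNIV :: 'a set))"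
  have "emeasure (markov_chain K x) (PF.emb UNIV {} (space ?S)) = emeasure (CI {}) (space ?S)"
    unfolding markov_chain_def by (rule lim) auto
  moreover have "PF.emb UNIV {} (space ?S) = UNIV"
    by (auto simp: prod_emb_def space_PiM)
  moreover have "space ?S = space (CI {})"
    by (simp add: CI_def)
  ultimately show ?thesis
    using prob_space.emeasure_space_1[OF PF.prob_space_P[of "{}"]] by (auto intro!: prob_spaceI)
qed

lemma finite_cliques: "finite (cliques n E)"
  by (rule finite_subset[of _ "Pow {..<n}"]) (auto simp: cliques_def)

lemma empty_in_cliques: "{} \<in> cliques n E"
  by (auto simp: cliques_def)

lemma partition_pos: "(\<Sum>D\<in>cliques n E. exp (\<beta> * h (card D))) > (0::real)"
  using finite_cliques empty_in_cliques[of n E] by (intro sum_pos) auto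

lemma pmf_gibbs:
  "pmf (gibbs n E h \<beta>) C = (if C \<in> cliques n E
     then exp (\<beta> * h (card C)) / (\<Sum>D\<in>cliques n E. exp (\<beta> * h (card D))) else 0)"
  (is "_ = ?f C")
proof -
  let ?Z = "\<Sum>D\<in>cliques n E. exp (\<beta> * h (card D))"
  have pos: "?Z > 0" by (rule partition_pos)
  have nn: "0 \<le> ?f D" for D using pos by (simp add: less_imp_le)
  have "(\<integral>\<^sup>+D. ennreal (?f D) \<partial>count_space UNIV) = (\<Sum>D\<in>cliques n E. ennreal (?f D))"
    using finite_cliques by (intro nn_integral_count_space') auto
  also have "\<dots> = ennreal (\<Sum>D\<in>cliques n E. ?f D)"
    using nn by (intro sum_ennreal)
  also have "(\<Sum>D\<in>cliques n E. ?f D) = 1"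
    using pos by (simp add: sum_divide_distrib[symmetric])
  finally show ?thesis
    unfolding gibbs_def using nn by (subst pmf_embed_pmf) auto
qed

lemma pmf_metropolis_step_neq:
  assumes "n > 0" "C \<noteq> D"
  shows "pmf (metropolis_step n E h \<beta> C) D =
    (if D \<in> cliques n E \<and> (\<exists>v<n. D = sym_diff C {v})
     then min 1 (exp (\<beta> * (h (card D) - h (card C)))) / n else 0)"
proof -
  let ?a = "min 1 (exp (\<beta> * (h (card D) - h (card C))))"
  have inj: "v = w" if "sym_diff C {v} = D" "sym_diff C {w} = D" for v w
    using that by blast
  have summand: "pmf (let C' = sym_diff C {v} in
        if C' \<in> cliques n E then
          bernoulli_pmf (min 1 (exp (\<beta> * (h (card C') - h (card C))))) \<bind>
            (\<lambda>accept. return_pmf (if accept then C' else C))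
        else return_pmf C) D = (if D \<in> cliques n E \<and> D = sym_diff C {v} then ?a else 0)" for v
    using assms(2) unfolding Let_def by (auto simp: pmf_bind indicator_def)
  have "pmf (metropolis_step n E h \<beta> C) D = measure_pmf.expectation (pmf_of_set {..<n})
      (\<lambda>v. if D \<in> cliques n E \<and> D = sym_diff C {v} then ?a else 0)"
    unfolding metropolis_step_def by (simp only: pmf_bind summand)
  also have "\<dots> = (\<Sum>v<n. if D \<in> cliques n E \<and> D = sym_diff C {v} then ?a else 0) / n"
    using assms(1) by (subst integral_pmf_of_set) auto
  also have "\<dots> = (if D \<in> cliques n E \<and> (\<exists>v<n. D = sym_diff C {v}) then ?a / n else 0)"
  proof (cases "D \<in> cliques n E \<and> (\<exists>v<n. D = sym_diff C {v})")
    case True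
    then obtain v where v: "v < n" "D = sym_diff C {v}" by blast
    have "(D \<in> cliques n E \<and> D = sym_diff C {w}) = (w = v)" for w
      using True v(2) inj[of v w] by (metis (no_types))
    then show ?thesis using True v(1) by simp
  next
    case False
    then have "(\<Sum>v<n. if D \<in> cliques n E \<and> D = sym_diff C {v} then ?a else 0) = 0"
      by (intro sum.neutral) auto
    with False show ?thesis by (simp only: if_False div_0)
  qed
  finally show ?thesis .
qed

lemma set_metropolis_step: "C \<in> cliques n E \<Longrightarrow> n > 0 \<Longrightarrow> set_pmf (metropolis_step n E h \<beta> C) \<subseteq> cliques n E"
  by (auto simp: metropolis_step_def Let_def split: if_splits)

lemma detailed_balance:
  assumes "n > 0" "C \<in> cliques n E" "D \<in> cliques n E"
  shows "pmf (gibbs n E h \<beta>) C * pmf (metropolis_step n E h \<beta> C) D =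
         pmf (gibbs n E h \<beta>) D * pmf (metropolis_step n E h \<beta> D) C"
proof (cases "C = D")
  case False
  have sym: "(\<exists>v<n. D = sym_diff C {v}) \<longleftrightarrow> (\<exists>v<n. C = sym_diff D {v})" (is "?P \<longleftrightarrow> ?Q")
    by (intro ex_cong1 conj_cong refl) auto
  have "exp x * min 1 (exp (y - x)) = exp y * min 1 (exp (x - y))" for x y :: real
    by (auto simp: min_def exp_diff)
  from this[of "\<beta> * h (card C)" "\<beta> * h (card D)"] have *: "exp (\<beta> * h (card C)) * min 1 (exp (\<beta> * (h (card D) - h (card C)))) =
      exp (\<beta> * h (card D)) * min 1 (exp (\<beta> * (h (card C) - h (card D))))"
    by (simp only: right_diff_distrib)
  show ?thesis
  proof (cases ?P)
    case True
    then show ?thesis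
      unfolding pmf_metropolis_step_neq[OF assms(1) False]
        pmf_metropolis_step_neq[OF assms(1) False[symmetric]] pmf_gibbs
      using assms sym * by (simp only: if_True simp_thms times_divide_times_eq)
  next
    case nP: False
    then show ?thesis
      unfolding pmf_metropolis_step_neq[OF assms(1) False]
        pmf_metropolis_step_neq[OF assms(1) False[symmetric]]
      using sym by (simp only: if_False simp_thms)
  qed
qed simp

lemma gibbs_stationary:
  assumes "n > 0"
  shows "bind_pmf (gibbs n E h \<beta>) (metropolis_step n E h \<beta>) = gibbs n E h \<beta>"
proof (rule pmf_eqI)
  fix D
  let ?g = "pmf (gibbs n E h \<beta>)" and ?k = "\<lambda>C. pmf (metropolis_step n E h \<beta> C)"
  have set: "set_pmf (gibbs n E h \<beta>) \<subseteq> cliques n E"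
    by (auto simp: set_pmf_eq pmf_gibbs)
  have "pmf (bind_pmf (gibbs n E h \<beta>) (metropolis_step n E h \<beta>)) D = (\<Sum>C\<in>cliques n E. ?k C D * ?g C)"
    using set by (simp add: pmf_bind integral_measure_pmf_real[OF finite_cliques] subset_iff)
  also have "\<dots> = ?g D"
  proof (cases "D \<in> cliques n E")
    case True
    have "(\<Sum>C\<in>cliques n E. ?k C D * ?g C) = (\<Sum>C\<in>cliques n E. ?g D * ?k D C)"
      using detailed_balance[OF assms _ True] by (intro sum.cong) (auto simp: mult.commute)
    also have "\<dots> = ?g D * (\<Sum>C\<in>cliques n E. ?k D C)"
      by (simp add: sum_distrib_left)
    also have "(\<Sum>C\<in>cliques n E. ?k D C) = 1"
      using set_metropolis_step[OF True assms] finite_cliques by (intro sum_pmf_eq_1)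
    finally show ?thesis by simp
  next
    case False
    have "?k C D = 0" if "C \<in> cliques n E" for C
      using set_metropolis_step[OF that assms] False by (auto simp: pmf_eq_0_set_pmf)
    with False show ?thesis by (simp add: pmf_gibbs)
  qed
  finally show "pmf (bind_pmf (gibbs n E h \<beta>) (metropolis_step n E h \<beta>)) D = ?g D" .
qed

end

theory Submission
  imports Defs "HOL-Real_Asymp.Real_Asymp"
begin

text \<open>
  Write \<open>L = log 2 n\<close>. By reversibility, \<open>P(X\<^sub>t = D | X\<^sub>0 = C)\<close> is
  \<open>exp (\<beta> (h |D| - h |C|)) = n\<^bsup>o(log n)\<^esup>\<close> times the probability that the process started in \<open>D\<close> is in \<open>C\<close>
  at time \<open>t\<close>, so for a large \<open>D\<close> it has to descend to a small clique. With high probability every clique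
  of size \<open>q \<le> (1 - \<delta>) L\<close> has at least \<open>n\<^bsup>1-o(1)\<^esup> 2\<^bsup>-q\<^esup>\<close> one-vertex extensions, against at most
  \<open>q\<close> removals; extra planted edges only help. Comparison with a birth-death chain therefore
  bounds the probability of a descent from size \<open>q\<close> by \<open>t n\<^bsup>o(log n)\<^esup> n\<^bsup>-q\<^esup> 2\<^bsup>q*q/2\<^esup>\<close>, where \<open>q\<close> is
  capped at \<open>(1 - \<delta>) L\<close>.

  It remains to count the cliques at which the process can first have size \<open>(1 + \<epsilon>) L\<close> or meet the
  planted clique in \<open>(1 - \<alpha>) L / 2\<close> vertices. The expected number of cliques of size \<open>x L\<close> with \<open>y L\<close>
  planted vertices is \<open>2\<close> to the power of about \<open>(x - x\<^sup>2/2 - (1 - \<alpha>) y + y\<^sup>2/2) L\<^sup>2\<close>. The first-moment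
  exponent \<open>x - x\<^sup>2/2\<close> is smaller at \<open>1 + \<epsilon>\<close> than at \<open>1 - \<delta>\<close>, and on the second part of the boundary the
  term in \<open>y\<close> is negative of order one. So the weighted count of boundary cliques is \<open>n\<^bsup>-\<Omega>(log n)\<^esup>\<close>.
\<close>

section \<open>Reversible finite Markov chains\<close>

lemma measure_markov_chain_cylinder:
  "measure (markov_chain K x) {\<omega>. \<forall>i\<le>t. \<omega> i = y i} =
     of_bool (y 0 = x) * (\<Prod>i<t. pmf (K (y i)) (y (Suc i)))"
  unfolding measure_def emeasure_markov_chain by (simp add: prod_nonneg)

lemma coordinate_in_sets_markov_chain [measurable]:
  "{\<omega>. P (\<omega> t)} \<in> sets (markov_chain K x)"
proof -
  have [measurable]: "(\<lambda>\<omega>. \<omega> t) \<in> Pi\<^sub>M (UNIV::nat set) (\<lambda>_. count_space (UNIV::'a set)) \<rightarrow>\<^sub>M count_space UNIV"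
    by (rule measurable_component_singleton) simp
  have "(\<lambda>\<omega>. \<omega> t) -` {z. P z} \<inter> space (Pi\<^sub>M (UNIV::nat set) (\<lambda>_. count_space (UNIV::'a set)))
      \<in> sets (Pi\<^sub>M (UNIV::nat set) (\<lambda>_. count_space (UNIV::'a set)))"
    by (rule measurable_sets[where A = "count_space UNIV"]) auto
  then show ?thesis
    by (simp add: sets_markov_chain space_PiM vimage_def)
qed

section \<open>Law of a chain confined to a finite state set\<close>

locale finite_markov_chain =
  fixes K :: "'a \<Rightarrow> 'a pmf" and S :: "'a set" and x :: 'a
  assumes finite_states: "finite S"
    and start: "x \<in> S"
    and closed: "y \<in> S \<Longrightarrow> set_pmf (K y) \<subseteq> S"
begin

sublocale prob_space "markov_chain K x"
  by (rule prob_space_markov_chain)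

lemma coordinate_pred [measurable]: "Measurable.pred (markov_chain K x) (\<lambda>\<omega>. P (\<omega> t))"
  using coordinate_in_sets_markov_chain[of P t K x] by (simp add: pred_def)

text \<open>This is the Markov property. The known probabilities are those of cylinders, and the
  state type may be infinite; confining the first \<open>t + 1\<close> coordinates to
  \<open>S\<close> turns both events into finite disjoint unions of cylinders.\<close>

lemma confined_step:
  "prob {\<omega>. (\<forall>i\<le>t. \<omega> i \<in> S) \<and> \<omega> t = y \<and> \<omega> (Suc t) = z} =
     prob {\<omega>. (\<forall>i\<le>t. \<omega> i \<in> S) \<and> \<omega> t = y} * pmf (K y) z"
proof -
  \<comment> \<open>Admissible path prefixes ending in \<open>y\<close>; taking them extensional
    makes each cylinder occur once.\<close>
  define Y where "Y = {p \<in> {..t} \<rightarrow>\<^sub>E S. p t = y}"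
  let ?A = "\<lambda>p. {\<omega>. \<forall>i\<le>t. \<omega> i = p i}"
  let ?B = "\<lambda>p. {\<omega>. \<forall>i\<le>Suc t. \<omega> i = (p(Suc t := z)) i}"
  have fin: "finite Y"
    unfolding Y_def using finite_states by (intro finite_subset[OF _ finite_PiE[of "{..t}" "\<lambda>_. S"]]) auto
  have meas: "{\<omega>. \<forall>i\<le>k. \<omega> i = p i} \<in> events" for k and p :: "nat \<Rightarrow> 'a"
  proof -
    have "{\<omega> \<in> space (markov_chain K x). \<forall>i\<le>k. \<omega> i = p i} \<in> events"
      by measurable
    then show ?thesis by simp
  qed
  have inj: "p = p'" if "p \<in> Y" "p' \<in> Y" "\<And>i. i \<le> t \<Longrightarrow> p i = p' i" for p p'
    using that unfolding Y_def by (intro PiE_ext[of p "{..t}" "\<lambda>_. S" p']) auto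
  have A: "{\<omega>. (\<forall>i\<le>t. \<omega> i \<in> S) \<and> \<omega> t = y} = (\<Union>p\<in>Y. ?A p)"
  proof (intro equalityI subsetI)
    fix \<omega> assume "\<omega> \<in> {\<omega>. (\<forall>i\<le>t. \<omega> i \<in> S) \<and> \<omega> t = y}"
    then have "restrict \<omega> {..t} \<in> Y" "\<omega> \<in> ?A (restrict \<omega> {..t})"
      by (auto simp: Y_def)
    then show "\<omega> \<in> (\<Union>p\<in>Y. ?A p)" by blast
  qed (auto simp: Y_def PiE_iff)
  have B: "{\<omega>. (\<forall>i\<le>t. \<omega> i \<in> S) \<and> \<omega> t = y \<and> \<omega> (Suc t) = z} = (\<Union>p\<in>Y. ?B p)"
  proof (intro equalityI subsetI)
    fix \<omega> assume "\<omega> \<in> {\<omega>. (\<forall>i\<le>t. \<omega> i \<in> S) \<and> \<omega> t = y \<and> \<omega> (Suc t) = z}"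
    then have "restrict \<omega> {..t} \<in> Y" "\<omega> \<in> ?B (restrict \<omega> {..t})"
      by (auto simp: Y_def le_Suc_eq)
    then show "\<omega> \<in> (\<Union>p\<in>Y. ?B p)" by blast
  next
    fix \<omega> assume "\<omega> \<in> (\<Union>p\<in>Y. ?B p)"
    then obtain p where p: "p \<in> Y" "\<And>i. i \<le> Suc t \<Longrightarrow> \<omega> i = (p(Suc t := z)) i" by blast
    have "\<omega> i = p i" if "i \<le> t" for i
      using p(2)[of i] that by simp
    moreover have "\<omega> (Suc t) = z"
      using p(2)[of "Suc t"] by simp
    ultimately show "\<omega> \<in> {\<omega>. (\<forall>i\<le>t. \<omega> i \<in> S) \<and> \<omega> t = y \<and> \<omega> (Suc t) = z}"
      using p(1) by (auto simp: Y_def PiE_iff)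
  qed
  have disjA: "disjoint_family_on ?A Y"
    by (auto simp: disjoint_family_on_def) (metis inj)
  have disjB: "disjoint_family_on ?B Y"
    unfolding disjoint_family_on_def
  proof (intro ballI impI)
    fix p p' assume p: "p \<in> Y" "p' \<in> Y" "p \<noteq> p'"
    then obtain i where "i \<le> t" "p i \<noteq> p' i" using inj by blast
    then show "?B p \<inter> ?B p' = {}"
      by (auto intro!: exI[of _ i])
  qed
  have "prob (?B p) = prob (?A p) * pmf (K y) z" if "p \<in> Y" for p
  proof -
    have "(\<Prod>i<t. pmf (K ((p(Suc t := z)) i)) ((p(Suc t := z)) (Suc i))) =
        (\<Prod>i<t. pmf (K (p i)) (p (Suc i)))"
      by (intro prod.cong) auto
    then show ?thesis
      using that unfolding measure_markov_chain_cylinder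
      by (simp add: Y_def)
  qed
  then show ?thesis
    unfolding A B using fin meas disjA disjB
    by (simp add: finite_measure_finite_Union image_subset_iff sum_distrib_right del: fun_upd_apply)
qed

lemma confined_start: "prob {\<omega>. \<omega> 0 = y} = of_bool (y = x)"
  using measure_markov_chain_cylinder[of K x 0 "\<lambda>_. y"] by simp

lemma confined_Suc:
  assumes "z \<in> S"
  shows "prob {\<omega>. (\<forall>i\<le>Suc t. \<omega> i \<in> S) \<and> \<omega> (Suc t) = z} =
     (\<Sum>y\<in>S. prob {\<omega>. (\<forall>i\<le>t. \<omega> i \<in> S) \<and> \<omega> t = y} * pmf (K y) z)"
proof -
  let ?B = "\<lambda>y. {\<omega> \<in> space (markov_chain K x). (\<forall>i\<le>t. \<omega> i \<in> S) \<and> \<omega> t = y \<and> \<omega> (Suc t) = z}"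
  have meas: "?B y \<in> events" for y by measurable
  have "{\<omega>. (\<forall>i\<le>Suc t. \<omega> i \<in> S) \<and> \<omega> (Suc t) = z} = (\<Union>y\<in>S. ?B y)"
    using assms by (auto simp: le_Suc_eq)
  then have "prob {\<omega>. (\<forall>i\<le>Suc t. \<omega> i \<in> S) \<and> \<omega> (Suc t) = z} = (\<Sum>y\<in>S. prob (?B y))"
    using meas finite_states
    by (simp only:) (intro finite_measure_finite_Union, auto simp: disjoint_family_on_def)
  then show ?thesis using confined_step by simp
qed

lemma confined_total: "(\<Sum>y\<in>S. prob {\<omega>. (\<forall>i\<le>t. \<omega> i \<in> S) \<and> \<omega> t = y}) = 1"
proof (induction t)
  case 0
  have "{\<omega>. (\<forall>i\<le>0::nat. \<omega> i \<in> S) \<and> \<omega> 0 = y} = {\<omega>. \<omega> 0 = y}" if "y \<in> S" for y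
    using that by (intro Collect_cong) auto
  then show ?case
    using finite_states start confined_start by (simp add: of_bool_def)
next
  case (Suc t)
  let ?f = "\<lambda>y. prob {\<omega>. (\<forall>i\<le>t. \<omega> i \<in> S) \<and> \<omega> t = y}"
  have "(\<Sum>z\<in>S. prob {\<omega>. (\<forall>i\<le>Suc t. \<omega> i \<in> S) \<and> \<omega> (Suc t) = z}) =
      (\<Sum>z\<in>S. \<Sum>y\<in>S. ?f y * pmf (K y) z)"
    by (intro sum.cong confined_Suc refl)
  also have "\<dots> = (\<Sum>y\<in>S. ?f y * (\<Sum>z\<in>S. pmf (K y) z))"
    by (subst sum.swap) (simp add: sum_distrib_left)
  also have "\<dots> = (\<Sum>y\<in>S. ?f y)"
    using closed finite_states by (intro sum.cong) (auto simp: sum_pmf_eq_1)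
  finally show ?case using Suc by simp
qed

lemma AE_confined: "AE \<omega> in markov_chain K x. \<forall>i. \<omega> i \<in> S"
proof -
  have "AE \<omega> in markov_chain K x. \<omega> t \<in> S" for t
  proof (rule AE_I_eq_1, unfold space_markov_chain)
    let ?B = "\<lambda>y. {\<omega> \<in> space (markov_chain K x). (\<forall>i\<le>t. \<omega> i \<in> S) \<and> \<omega> t = y}"
    have meas: "?B y \<in> events" for y by measurable
    have "1 = (\<Sum>y\<in>S. prob (?B y))"
      using confined_total[of t] by simp
    also have "\<dots> = prob (\<Union>y\<in>S. ?B y)"
      using meas finite_states
      by (intro finite_measure_finite_Union[symmetric]) (auto simp: disjoint_family_on_def)
    also have "\<dots> \<le> prob {\<omega> \<in> UNIV. \<omega> t \<in> S}"
      by (intro finite_measure_mono) auto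
    finally show "emeasure (markov_chain K x) {\<omega> \<in> UNIV. \<omega> t \<in> S} = 1"
      using prob_le_1[of "{\<omega>. \<omega> t \<in> S}"] by (simp add: emeasure_eq_measure)
  qed auto
  then show ?thesis by (simp add: AE_all_countable)
qed

lemma prob_confined: "prob {\<omega>. \<omega> t = y} = prob {\<omega>. (\<forall>i\<le>t. \<omega> i \<in> S) \<and> \<omega> t = y}"
proof (rule finite_measure_eq_AE)
  have "{\<omega> \<in> space (markov_chain K x). (\<forall>i\<le>t. \<omega> i \<in> S) \<and> \<omega> t = y} \<in> events" by measurable
  then show "{\<omega>. (\<forall>i\<le>t. \<omega> i \<in> S) \<and> \<omega> t = y} \<in> events" by simp
qed (use AE_confined in auto)

lemma prob_Suc:
  "z \<in> S \<Longrightarrow> prob {\<omega>. \<omega> (Suc t) = z} = (\<Sum>y\<in>S. prob {\<omega>. \<omega> t = y} * pmf (K y) z)"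
  unfolding prob_confined by (rule confined_Suc)

text \<open>Lets hitting arguments be made on individual paths. The forbidden transitions form a
  null set, being finitely many pairs of states at countably many times.\<close>

lemma AE_path: "AE \<omega> in markov_chain K x. \<omega> 0 = x \<and> (\<forall>t. \<omega> t \<in> S \<and> \<omega> (Suc t) \<in> set_pmf (K (\<omega> t)))"
proof -
  have "AE \<omega> in markov_chain K x. \<omega> 0 = x"
    by (rule AE_I_eq_1) (use confined_start[of x] in \<open>simp_all add: emeasure_eq_measure\<close>)
  moreover have "AE \<omega> in markov_chain K x. \<not> (\<omega> t = y \<and> \<omega> (Suc t) = z)"
    if "y \<in> S" "z \<in> S" "z \<notin> set_pmf (K y)" for t y z
  proof -
    let ?B = "{\<omega> \<in> space (markov_chain K x). (\<forall>i\<le>t. \<omega> i \<in> S) \<and> \<omega> t = y \<and> \<omega> (Suc t) = z}"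
    have "?B \<in> events" by measurable
    moreover have "emeasure (markov_chain K x) ?B = 0"
      using confined_step[of t y z] that by (simp add: emeasure_eq_measure set_pmf_iff)
    ultimately have "AE \<omega> in markov_chain K x. \<omega> \<notin> ?B"
      by (rule AE_not_in[OF null_setsI[rotated]])
    with AE_confined show ?thesis by eventually_elim auto
  qed
  then have "AE \<omega> in markov_chain K x. \<forall>t. \<forall>y\<in>S. \<forall>z\<in>S. z \<notin> set_pmf (K y) \<longrightarrow> \<not> (\<omega> t = y \<and> \<omega> (Suc t) = z)"
    using finite_states by (intro AE_all_countable[THEN iffD2] allI AE_finite_allI) auto
  ultimately show ?thesis
    using AE_confined by eventually_elim metis
qed

text \<open>
  Reversibility turns the forward equation for the ratio \<open>P(X\<^sub>t = y) / w y\<close> into the backward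
  equation, so this ratio is dominated by any multiple of \<open>V\<close> that dominates it at time \<open>0\<close>, up to the
  accumulated drift.
\<close>

lemma prob_le_drift:
  fixes w V :: "'a \<Rightarrow> real"
  assumes w: "\<And>y. y \<in> S \<Longrightarrow> w y > 0"
    and rev: "\<And>y z. y \<in> S \<Longrightarrow> z \<in> S \<Longrightarrow> w y * pmf (K y) z = w z * pmf (K z) y"
    and V: "\<And>y. y \<in> S \<Longrightarrow> V y > 0"
    and drift: "\<And>y. y \<in> S \<Longrightarrow> (\<Sum>z\<in>S. pmf (K y) z * V z) \<le> V y + \<eta>"
    and y: "y \<in> S"
  shows "prob {\<omega>. \<omega> t = y} \<le> w y * (V y + real t * \<eta>) / (w x * V x)"
  using y
proof (induction t arbitrary: y)
  case 0
  show ?case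
  proof (cases "y = x")
    case True
    then show ?thesis using confined_start[of y] w[OF start] V[OF start] by simp
  next
    case False
    then show ?thesis
      using confined_start[of y] w[OF start] V[OF start] w[OF 0] V[OF 0] by simp
  qed
next
  case (Suc t)
  let ?c = "w x * V x"
  have c: "?c > 0" using w[OF start] V[OF start] by simp
  have "prob {\<omega>. \<omega> (Suc t) = y} = (\<Sum>z\<in>S. prob {\<omega>. \<omega> t = z} * pmf (K z) y)"
    by (rule prob_Suc[OF Suc.prems])
  also have "\<dots> \<le> (\<Sum>z\<in>S. w z * (V z + real t * \<eta>) / ?c * pmf (K z) y)"
    using Suc.IH by (intro sum_mono mult_right_mono) auto
  also have "\<dots> = (\<Sum>z\<in>S. w y * pmf (K y) z * (V z + real t * \<eta>) / ?c)"
    using rev[OF Suc.prems] by (intro sum.cong) (auto simp: mult_ac)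
  also have "\<dots> = w y * ((\<Sum>z\<in>S. pmf (K y) z * V z) + real t * \<eta> * (\<Sum>z\<in>S. pmf (K y) z)) / ?c"
    by (simp add: sum_distrib_left sum_divide_distrib sum.distrib[symmetric] algebra_simps
        add_divide_distrib)
  also have "\<dots> \<le> w y * (V y + real (Suc t) * \<eta>) / ?c"
    using drift[OF Suc.prems] w[OF Suc.prems] c sum_pmf_eq_1[OF finite_states closed[OF Suc.prems]]
    by (intro divide_right_mono mult_left_mono) (auto simp: algebra_simps)
  finally show ?case .
qed

text \<open>Union bound over the \<open>T + 1\<close> times and the states of \<open>B\<close>, with
  the accumulated drift at time \<open>t\<close> replaced by its value at \<open>T\<close>.\<close>

lemma prob_hit_le_drift:
  fixes w V :: "'a \<Rightarrow> real"
  assumes w: "\<And>y. y \<in> S \<Longrightarrow> w y > 0"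
    and rev: "\<And>y z. y \<in> S \<Longrightarrow> z \<in> S \<Longrightarrow> w y * pmf (K y) z = w z * pmf (K z) y"
    and V: "\<And>y. y \<in> S \<Longrightarrow> V y > 0"
    and drift: "\<And>y. y \<in> S \<Longrightarrow> (\<Sum>z\<in>S. pmf (K y) z * V z) \<le> V y + \<eta>"
    and \<eta>: "\<eta> \<ge> 0"
    and B: "B \<subseteq> S"
    and hit: "\<And>\<omega>. \<omega> 0 = x \<Longrightarrow> (\<And>t. \<omega> t \<in> S \<and> \<omega> (Suc t) \<in> set_pmf (K (\<omega> t))) \<Longrightarrow>
      \<omega> \<in> H \<Longrightarrow> \<exists>t\<le>T. \<omega> t \<in> B"
  shows "prob H \<le> (real T + 1) * (\<Sum>y\<in>B. w y * (V y + real T * \<eta>) / (w x * V x))"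
proof -
  let ?A = "\<lambda>(t, y). {\<omega>. \<omega> t = y}"
  have fin: "finite B" using B finite_states by (rule finite_subset)
  have "prob H \<le> prob (\<Union>p\<in>{..T} \<times> B. ?A p)"
  proof (rule finite_measure_mono_AE)
    show "AE \<omega> in markov_chain K x. \<omega> \<in> H \<longrightarrow> \<omega> \<in> (\<Union>p\<in>{..T} \<times> B. ?A p)"
      using AE_path by eventually_elim (use hit in force)
  qed (use fin in \<open>auto intro!: sets.finite_UN\<close>)
  also have "\<dots> \<le> (\<Sum>p\<in>{..T} \<times> B. prob (?A p))"
    using fin by (intro finite_measure_subadditive_finite) auto
  also have "\<dots> \<le> (\<Sum>(t, y)\<in>{..T} \<times> B. w y * (V y + real T * \<eta>) / (w x * V x))"
  proof (rule sum_mono)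
    fix p assume p: "p \<in> {..T} \<times> B"
    obtain t y where ty: "p = (t, y)" by (rule prod.exhaust)
    with p have t: "t \<le> T" and "y \<in> B" by auto
    then have y: "y \<in> S" using B by auto
    have "prob {\<omega>. \<omega> t = y} \<le> w y * (V y + real t * \<eta>) / (w x * V x)"
      by (rule prob_le_drift[OF w rev V drift y])
    also have "\<dots> \<le> w y * (V y + real T * \<eta>) / (w x * V x)"
      using w[OF start] V[OF start] w[OF y] t \<eta>
      by (intro divide_right_mono mult_left_mono add_left_mono mult_right_mono) auto
    finally show "prob (?A p) \<le> (case p of (t, y) \<Rightarrow> w y * (V y + real T * \<eta>) / (w x * V x))"
      by (simp add: ty)
  qed
  also have "\<dots> = (real T + 1) * (\<Sum>y\<in>B. w y * (V y + real T * \<eta>) / (w x * V x))"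
    by (simp add: sum.cartesian_product[symmetric])
  finally show ?thesis .
qed

end

section \<open>First-moment estimates in the random graph\<close>

text \<open>Independent fair edges make the edge set uniform, so the probabilities below reduce to
  counting edge sets.\<close>

lemma gnp_half_conv_pmf_of_set: "gnp_half n = pmf_of_set (Pow (nsets {..<n} 2))"
  unfolding gnp_half_def
  by (rule pmf_of_set_Pow_conv_bernoulli) (simp add: finite_imp_finite_nsets)

lemma card_supersets:
  assumes "finite S" "F \<subseteq> S"
  shows "real (card {E \<in> Pow S. F \<subseteq> E}) = 2 ^ card S / 2 ^ card F"
proof -
  have "{E \<in> Pow S. F \<subseteq> E} = (\<union>) F ` Pow (S - F)"
  proof (intro equalityI subsetI)
    fix E assume "E \<in> {E \<in> Pow S. F \<subseteq> E}"
    then have "E = F \<union> (E - F)" "E - F \<in> Pow (S - F)" by auto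
    then show "E \<in> (\<union>) F ` Pow (S - F)" by (rule image_eqI)
  qed (use assms in auto)
  moreover have "inj_on ((\<union>) F) (Pow (S - F))"
    by (auto simp: inj_on_def)
  ultimately have "card {E \<in> Pow S. F \<subseteq> E} = 2 ^ card (S - F)"
    using assms by (simp add: card_image card_Pow)
  moreover have "card (S - F) = card S - card F"
    using assms by (meson card_Diff_subset finite_subset)
  moreover have "card F \<le> card S" using assms by (simp add: card_mono)
  ultimately show ?thesis by (simp only: of_nat_power of_nat_numeral) (simp add: power_diff)
qed

text \<open>Independence in counting form: the induction peels off one block at a time, and each
  block may use \<open>2 ^ q - 1\<close> of its \<open>2 ^ q\<close> subsets.\<close>

lemma card_avoiding_blocks:
  fixes B :: "'b \<Rightarrow> 'a set"
  assumes "finite W" "finite S" "\<And>v. v \<in> W \<Longrightarrow> B v \<subseteq> S" "\<And>v. v \<in> W \<Longrightarrow> card (B v) = q"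
    and "disjoint_family_on B W"
  shows "real (card {E \<in> Pow S. \<forall>v\<in>W. \<not> B v \<subseteq> E}) = 2 ^ card S * (1 - 1 / 2 ^ q) ^ card W"
  using assms
proof (induction W arbitrary: S rule: finite_induct)
  case empty
  then show ?case using card_Pow[of S] by (simp add: Pow_def)
next
  case (insert w W)
  let ?X = "{E \<in> Pow (S - B w). \<forall>v\<in>W. \<not> B v \<subseteq> E}"
  have disj: "B v \<inter> B w = {}" if "v \<in> W" for v
    using insert.prems(4) insert.hyps(2) that by (auto simp: disjoint_family_on_def)
  have fin: "finite (B w)"
    using insert.prems by (auto intro: finite_subset)
  have Bw: "B w \<subseteq> S" using insert.prems by auto
  have avoid: "B v \<subseteq> Y \<union> Z \<longleftrightarrow> B v \<subseteq> Y" if "v \<in> W" "Z \<subseteq> B w" for v Y Z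
    using disj[OF that(1)] that(2) by blast
  \<comment> \<open>A set splits into its part outside \<open>B w\<close> and a proper subset of
    \<open>B w\<close>. By disjointness the conditions on the other blocks see the first part
    only.\<close>
  have "bij_betw (\<lambda>(Y, Z). Y \<union> Z) (?X \<times> (Pow (B w) - {B w}))
      {E \<in> Pow S. \<forall>v\<in>insert w W. \<not> B v \<subseteq> E}"
  proof (rule bij_betwI[where g = "\<lambda>E. (E - B w, E \<inter> B w)"])
    show "(\<lambda>(Y, Z). Y \<union> Z) \<in> ?X \<times> (Pow (B w) - {B w}) \<rightarrow> {E \<in> Pow S. \<forall>v\<in>insert w W. \<not> B v \<subseteq> E}"
    proof (rule funcsetI)
      fix p assume p: "p \<in> ?X \<times> (Pow (B w) - {B w})"
      obtain Y Z where YZp: "p = (Y, Z)" by (rule prod.exhaust)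
      with p have YZ: "Y \<subseteq> S - B w" "\<forall>v\<in>W. \<not> B v \<subseteq> Y" "Z \<subseteq> B w" "Z \<noteq> B w" by auto
      then have "\<not> B v \<subseteq> Y \<union> Z" if "v \<in> W" for v
        using avoid[OF that YZ(3)] that by blast
      moreover have "\<not> B w \<subseteq> Y \<union> Z" using YZ by blast
      ultimately show "(case p of (Y, Z) \<Rightarrow> Y \<union> Z) \<in> {E \<in> Pow S. \<forall>v\<in>insert w W. \<not> B v \<subseteq> E}"
        using YZ Bw by (simp add: YZp) blast
    qed
    show "(\<lambda>E. (E - B w, E \<inter> B w)) \<in> {E \<in> Pow S. \<forall>v\<in>insert w W. \<not> B v \<subseteq> E} \<rightarrow>
        ?X \<times> (Pow (B w) - {B w})"
      by (intro funcsetI) blast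
  qed auto
  from bij_betw_same_card[OF this]
  have "card {E \<in> Pow S. \<forall>v\<in>insert w W. \<not> B v \<subseteq> E} = card ?X * card (Pow (B w) - {B w})"
    by (simp only: card_cartesian_product)
  moreover have "real (card (Pow (B w) - {B w})) = 2 ^ q - 1"
    using fin insert.prems(3)[of w] by (simp add: card_Pow of_nat_diff)
  moreover have "real (card ?X) = 2 ^ card (S - B w) * (1 - 1 / 2 ^ q) ^ card W"
  proof (intro insert.IH)
    show "B v \<subseteq> S - B w" if "v \<in> W" for v
      using disj[OF that] insert.prems(2)[of v] that by blast
  qed (use insert.prems in \<open>auto simp: disjoint_family_on_def\<close>)
  moreover have "card (S - B w) = card S - q" "q \<le> card S"
    using fin Bw insert.prems(1,3) by (simp_all add: card_Diff_subset) (metis card_mono insertI1)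
  ultimately have "real (card {E \<in> Pow S. \<forall>v\<in>insert w W. \<not> B v \<subseteq> E}) =
      2 ^ (card S - q) * (1 - 1 / 2 ^ q) ^ card W * (2 ^ q - 1)" and "q \<le> card S"
    by (simp_all only: of_nat_mult)
  then show ?case
    using insert.hyps by (simp add: power_diff field_simps)
qed

lemma prob_gnp_half:
  "measure_pmf.prob (gnp_half n) {E. P E} =
     real (card {E \<in> Pow (nsets {..<n} 2). P E}) / 2 ^ card (nsets {..<n} 2)"
proof -
  have fin: "finite (nsets {..<n} 2)" by (simp add: finite_imp_finite_nsets)
  have "Pow (nsets {..<n} 2) \<inter> {E. P E} = {E \<in> Pow (nsets {..<n} 2). P E}" by auto
  then show ?thesis
    using fin unfolding gnp_half_conv_pmf_of_set
    by (subst measure_pmf_of_set) (auto simp: card_Pow)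
qed

lemma prob_gnp_half_superset:
  assumes "F \<subseteq> nsets {..<n} 2"
  shows "measure_pmf.prob (gnp_half n) {E. F \<subseteq> E} = 1 / 2 ^ card F"
proof -
  have "real (card {E \<in> Pow (nsets {..<n} 2). F \<subseteq> E}) = 2 ^ card (nsets {..<n} 2) / 2 ^ card F"
    by (rule card_supersets[OF _ assms]) (simp add: finite_imp_finite_nsets)
  then show ?thesis unfolding prob_gnp_half by simp
qed

section \<open>Common neighbourhoods of vertex sets\<close>

text \<open>Later \<open>C\<close> is a clique of the planted graph while \<open>E\<close> is the
  graph before planting, in which \<open>C\<close> may fail to be a clique. Each such neighbour
  still extends \<open>C\<close> in the planted graph.\<close>

definition common_neighbours :: "nat \<Rightarrow> nat set set \<Rightarrow> nat set \<Rightarrow> nat set" where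
  "common_neighbours n E C = {v \<in> {..<n} - C. \<forall>c\<in>C. {v, c} \<in> E}"

text \<open>The stars joining the vertices of \<open>W\<close> to \<open>C\<close> have
  \<open>card C\<close> edges each and are pairwise disjoint because the centres lie outside
  \<open>C\<close>.\<close>

lemma prob_no_common_neighbours:
  assumes "C \<subseteq> {..<n}" "W \<subseteq> {..<n} - C"
  shows "measure_pmf.prob (gnp_half n) {E. common_neighbours n E C \<inter> W = {}} =
    (1 - 1 / 2 ^ card C) ^ card W"
proof -
  let ?B = "\<lambda>v. (\<lambda>c. {v, c}) ` C"
  have fin: "finite (nsets {..<n} 2)" by (simp add: finite_imp_finite_nsets)
  have eq: "common_neighbours n E C \<inter> W = {} \<longleftrightarrow> (\<forall>v\<in>W. \<not> ?B v \<subseteq> E)" for E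
  proof -
    have "v \<in> {..<n} - C" if "v \<in> W" for v using assms that by blast
    then show ?thesis by (auto simp only: common_neighbours_def image_subset_iff)
  qed
  have "real (card {E \<in> Pow (nsets {..<n} 2). \<forall>v\<in>W. \<not> ?B v \<subseteq> E}) =
      2 ^ card (nsets {..<n} 2) * (1 - 1 / 2 ^ card C) ^ card W"
  proof (rule card_avoiding_blocks)
    show "finite W" using assms finite_subset by blast
    show "?B v \<subseteq> nsets {..<n} 2" if "v \<in> W" for v
      using that assms by auto
    show "card (?B v) = card C" if "v \<in> W" for v
      by (intro card_image) (auto simp: inj_on_def doubleton_eq_iff)
    show "disjoint_family_on ?B W"
      unfolding disjoint_family_on_def
    proof (intro ballI impI)
      fix v v' assume "v \<in> W" "v' \<in> W" "v \<noteq> v'"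
      then have "v \<notin> C" "v' \<notin> C" using assms by auto
      then show "?B v \<inter> ?B v' = {}" using \<open>v \<noteq> v'\<close> by (auto simp: doubleton_eq_iff)
    qed
  qed (rule fin)
  then show ?thesis unfolding prob_gnp_half eq by simp
qed

text \<open>
  The union bound over all sets of size \<open>j\<close> covering the common neighbours replaces a Chernoff bound: the
  factor \<open>n\<^bsup>j\<^esup>\<close> is harmless when \<open>j\<close> is below the mean by a factor of order \<open>log n\<close>.
\<close>

lemma prob_few_common_neighbours:
  assumes C: "C \<subseteq> {..<n}" and j: "j \<le> n" "card C + j \<le> n"
  shows "measure_pmf.prob (gnp_half n) {E. card (common_neighbours n E C) \<le> j} \<le>
    real n ^ j * exp (- (real n - real (card C) - real j) / 2 ^ card C)"
proof -
  let ?J = "{S. S \<subseteq> {..<n} \<and> card S = j}"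
  let ?b = "exp (- (real n - real (card C) - real j) / 2 ^ card C)"
  have finJ: "finite ?J" by (rule finite_subset[of _ "Pow {..<n}"]) auto
  have "{E. card (common_neighbours n E C) \<le> j} \<subseteq>
      (\<Union>S\<in>?J. {E. common_neighbours n E C \<inter> ({..<n} - C - S) = {}})"
  proof
    fix E assume "E \<in> {E. card (common_neighbours n E C) \<le> j}"
    then have le: "card (common_neighbours n E C) \<le> j" by simp
    \<comment> \<open>Padding to size exactly \<open>j\<close> leaves \<open>n choose j\<close> sets
      for the union bound.\<close>
    have "\<exists>S. common_neighbours n E C \<subseteq> S \<and> S \<subseteq> {..<n} \<and> card S = j"
      using le j(1) by (intro exists_subset_between) (auto simp: common_neighbours_def)
    then show "E \<in> (\<Union>S\<in>?J. {E. common_neighbours n E C \<inter> ({..<n} - C - S) = {}})"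
      by blast
  qed
  then have "measure_pmf.prob (gnp_half n) {E. card (common_neighbours n E C) \<le> j} \<le>
      measure_pmf.prob (gnp_half n) (\<Union>S\<in>?J. {E. common_neighbours n E C \<inter> ({..<n} - C - S) = {}})"
    by (intro measure_pmf.finite_measure_mono) auto
  also have "\<dots> \<le> (\<Sum>S\<in>?J. measure_pmf.prob (gnp_half n) {E. common_neighbours n E C \<inter> ({..<n} - C - S) = {}})"
    using finJ by (intro measure_pmf.finite_measure_subadditive_finite) auto
  also have "\<dots> \<le> (\<Sum>S\<in>?J. ?b)"
  proof (rule sum_mono)
    fix S assume S: "S \<in> ?J"
    let ?W = "{..<n} - C - S"
    have "card ?W \<ge> card ({..<n} - C) - card S"
      by (intro diff_card_le_card_Diff) (use S finite_subset in blast)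
    moreover have "card ({..<n} - C) = n - card C"
      using C finite_subset[OF C] by (simp add: card_Diff_subset)
    ultimately have W: "real (card ?W) \<ge> real n - real (card C) - real j"
      using S by auto
    have "measure_pmf.prob (gnp_half n) {E. common_neighbours n E C \<inter> ?W = {}} = (1 - 1 / 2 ^ card C) ^ card ?W"
      using C by (intro prob_no_common_neighbours) auto
    also have "\<dots> \<le> exp (- (1 / 2 ^ card C)) ^ card ?W"
      using exp_ge_add_one_self[of "- (1 / 2 ^ card C)"] by (intro power_mono) (auto simp: field_simps)
    also have "\<dots> = exp (- real (card ?W) / 2 ^ card C)"
      by (simp add: exp_of_nat_mult[symmetric])
    also have "\<dots> \<le> ?b"
      using W by (intro iffD2[OF exp_le_cancel_iff] divide_right_mono) auto
    finally show "measure_pmf.prob (gnp_half n) {E. common_neighbours n E C \<inter> ?W = {}} \<le> ?b" .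
  qed
  also have "\<dots> = real (n choose j) * ?b"
    by (simp add: n_subsets)
  also have "\<dots> \<le> real n ^ j * ?b"
    using binomial_le_pow[OF j(1)] by (intro mult_right_mono) (auto simp flip: of_nat_power)
  finally show ?thesis .
qed

section \<open>Cliques by size and overlap with the planted set\<close>

text \<open>\<open>D\<close> is determined by the pair \<open>D \<inter> P\<close>,
  \<open>D - P\<close>; the two binomial coefficients are then bounded by powers.\<close>

lemma card_subsets_meeting:
  assumes "finite A" "P \<subseteq> A" "r \<le> q"
  shows "card {D. D \<subseteq> A \<and> card D = q \<and> card (D \<inter> P) = r} \<le> card P ^ r * card A ^ (q - r)"
proof -
  have finP: "finite P" using assms finite_subset by blast
  have le: "x choose i \<le> x ^ i" for x i :: nat
    by (cases "i \<le> x") (auto simp: binomial_le_pow binomial_eq_0)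
  let ?f = "\<lambda>D. (D \<inter> P, D - P)"
  let ?Y = "{S. S \<subseteq> P \<and> card S = r} \<times> {S. S \<subseteq> A \<and> card S = q - r}"
  have "inj_on ?f {D. D \<subseteq> A \<and> card D = q \<and> card (D \<inter> P) = r}"
    by (auto simp: inj_on_def)
  moreover have "?f ` {D. D \<subseteq> A \<and> card D = q \<and> card (D \<inter> P) = r} \<subseteq> ?Y"
    using assms(1) finP by (auto simp: card_Diff_subset_Int)
  moreover have "finite ?Y"
    using assms finP by (auto intro: finite_subset[of _ "Pow P"] finite_subset[of _ "Pow A"])
  ultimately have "card {D. D \<subseteq> A \<and> card D = q \<and> card (D \<inter> P) = r} \<le> card ?Y"
    by (rule card_inj_on_le)
  also have "\<dots> = (card P choose r) * (card A choose (q - r))"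
    using assms finP by (simp add: card_cartesian_product n_subsets)
  also have "\<dots> \<le> card P ^ r * card A ^ (q - r)"
    by (intro mult_mono le) auto
  finally show ?thesis .
qed

lemma clique_iff_nsets_subset: "clique D E \<longleftrightarrow> nsets D 2 \<subseteq> E"
proof
  assume "clique D E"
  then show "nsets D 2 \<subseteq> E"
    unfolding clique_def by (auto elim!: nsets2_E)
next
  assume *: "nsets D 2 \<subseteq> E"
  show "clique D E"
    unfolding clique_def
  proof (intro ballI impI)
    fix v w assume "v \<in> D" "w \<in> D" "v \<noteq> w"
    then have "{v, w} \<in> nsets D 2" by simp
    then show "{v, w} \<in> E" using * by (rule subsetD[rotated])
  qed
qed

lemma nsets_Int: "nsets (A \<inter> B) k = nsets A k \<inter> nsets B k"
  by (auto simp: nsets_def)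

text \<open>Pairs inside \<open>P\<close> are edges for certain, so only the pairs of
  \<open>D\<close> that are not contained in \<open>P\<close> cost a factor 1/2.\<close>

lemma prob_clique_planted:
  assumes D: "D \<subseteq> {..<n}"
  shows "measure_pmf.prob (gnp_half n) {E. clique D (E \<union> nsets P 2)} =
    1 / 2 ^ ((card D choose 2) - (card (D \<inter> P) choose 2))"
proof -
  let ?F = "nsets D 2 - nsets (D \<inter> P) 2"
  have finD: "finite D" using D finite_subset by blast
  have "clique D (E \<union> nsets P 2) \<longleftrightarrow> ?F \<subseteq> E" for E
    unfolding clique_iff_nsets_subset nsets_Int by blast
  moreover have "?F \<subseteq> nsets {..<n} 2" using D by (auto simp: nsets_def)
  moreover have "card ?F = (card D choose 2) - (card (D \<inter> P) choose 2)"
  proof (subst card_Diff_subset)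
    show "finite (nsets (D \<inter> P) 2)" using finD by (simp add: finite_imp_finite_nsets)
    show "nsets (D \<inter> P) 2 \<subseteq> nsets D 2" by (auto simp: nsets_def)
  qed (use finD in simp)
  ultimately show ?thesis using prob_gnp_half_superset[of ?F n] by simp
qed

section \<open>Drift of the Metropolis process\<close>

lemma set_pmf_metropolis_step:
  "n > 0 \<Longrightarrow> D \<in> set_pmf (metropolis_step n E h \<beta> C) \<Longrightarrow> D = C \<or> (\<exists>v<n. D = sym_diff C {v})"
  using pmf_metropolis_step_neq[of n C D E h \<beta>] by (metis set_pmf_iff)

lemma subset_in_cliques: "C \<in> cliques n E \<Longrightarrow> D \<subseteq> C \<Longrightarrow> D \<in> cliques n E"
  by (auto simp: cliques_def clique_def)

lemma finite_clique: "C \<in> cliques n E \<Longrightarrow> finite C"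
  by (auto simp: cliques_def intro: finite_subset)

lemma insert_common_neighbour_in_cliques:
  assumes "C \<in> cliques n E" "E' \<subseteq> E" "v \<in> common_neighbours n E' C"
  shows "v < n" "v \<notin> C" "insert v C \<in> cliques n E"
  using assms by (auto simp: cliques_def clique_def common_neighbours_def insert_commute subset_iff)

lemma finite_markov_chain_metropolis:
  "n > 0 \<Longrightarrow> C \<in> cliques n E \<Longrightarrow> finite_markov_chain (metropolis_step n E h \<beta>) (cliques n E) C"
  by unfold_locales (auto simp: finite_cliques dest: set_metropolis_step[THEN subsetD])

text \<open>Detailed balance with the partition function cancelled; the unnormalised weights serve
  as \<open>w\<close> in \<open>prob_hit_le_drift\<close>.\<close>

lemma metropolis_step_reversible:
  assumes "n > 0" "C \<in> cliques n E" "D \<in> cliques n E"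
  shows "exp (\<beta> * h (card C)) * pmf (metropolis_step n E h \<beta> C) D =
    exp (\<beta> * h (card D)) * pmf (metropolis_step n E h \<beta> D) C"
  using detailed_balance[OF assms, of h \<beta>] partition_pos[of \<beta> h n E] assms(2,3)
  by (simp add: pmf_gibbs)

text \<open>The potential \<open>g\<close> falls on upward moves, each of probability at least
  \<open>a / n\<close>, and rises on the \<open>card D\<close> downward moves, each of probability
  at most \<open>1 / n\<close>. The hypothesis \<open>balance\<close> says that the upward moves
  win.\<close>

lemma metropolis_step_drift:
  fixes g :: "nat \<Rightarrow> real"
  assumes n: "n > 0" and D: "D \<in> cliques n E" and E': "E' \<subseteq> E"
    and a: "0 \<le> a" "a \<le> 1" "a \<le> exp (\<beta> * (h (Suc (card D)) - h (card D)))"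
    and dec: "g (Suc (card D)) \<le> g (card D)" "g (card D) \<le> g (card D - 1)"
    and balance: "real (card D) * (g (card D - 1) - g (card D)) \<le>
      real (card (common_neighbours n E' D)) * a * (g (card D) - g (Suc (card D)))"
  shows "(\<Sum>z\<in>cliques n E. pmf (metropolis_step n E h \<beta> D) z * g (card z)) \<le> g (card D)"
proof -
  let ?S = "cliques n E" and ?k = "pmf (metropolis_step n E h \<beta> D)" and ?q = "card D"
  define U where "U = {v \<in> {..<n} - D. insert v D \<in> ?S}"
  \<comment> \<open>Weighted change of potential: its sum is the drift because the transition
    probabilities sum to 1, and staying at \<open>D\<close> contributes 0.\<close>
  define F where "F z = ?k z * (g (card z) - g ?q)" for z
  let ?N = "(\<lambda>v. insert v D) ` U" and ?M = "(\<lambda>v. D - {v}) ` D"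
  note fin = finite_clique[OF D]
  have finU: "finite U" by (simp add: U_def)
  have Dn: "D \<subseteq> {..<n}" using D by (simp add: cliques_def)
  have M: "?M \<subseteq> ?S" by (auto intro: subset_in_cliques[OF D])
  have zero: "F z = 0" if z: "z \<in> ?S - (?N \<union> ?M)" for z
  proof (cases "z = D")
    case True
    then show ?thesis by (simp add: F_def)
  next
    case False
    have "\<not> (\<exists>v<n. z = sym_diff D {v})"
    proof
      assume "\<exists>v<n. z = sym_diff D {v}"
      then obtain v where v: "v < n" "z = sym_diff D {v}" by blast
      show False
      proof (cases "v \<in> D")
        case True
        then have "z = D - {v}" using v by auto
        then show False using z True by blast
      next
        case nv: False
        then have "z = insert v D" using v by auto
        then show False using z v(1) nv by (auto simp: U_def)
      qed
    qed
    then have "?k z = 0"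
      unfolding pmf_metropolis_step_neq[OF n False[symmetric]] by (simp only: simp_thms if_False)
    then show ?thesis by (simp add: F_def)
  qed
  have up: "F (insert v D) \<le> a / n * (g (Suc ?q) - g ?q)" if v: "v \<in> U" for v
  proof -
    have vD: "v \<notin> D" "v < n" "insert v D \<in> ?S" using v by (auto simp: U_def)
    then have ne: "D \<noteq> insert v D" by blast
    have "insert v D = sym_diff D {v}" using vD(1) by auto
    then have "?k (insert v D) = min 1 (exp (\<beta> * (h (card (insert v D)) - h ?q))) / n"
      unfolding pmf_metropolis_step_neq[OF n ne] using vD by (intro if_P) blast
    moreover have "card (insert v D) = Suc ?q" using fin vD(1) by simp
    ultimately have "?k (insert v D) \<ge> a / n"
      using a(2,3) by (simp add: divide_right_mono)
    then show ?thesis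
      using dec(1) unfolding F_def \<open>card (insert v D) = Suc ?q\<close>
      by (intro mult_right_mono_neg) auto
  qed
  have down: "F (D - {v}) \<le> 1 / n * (g (?q - 1) - g ?q)" if v: "v \<in> D" for v
  proof -
    have ne: "D \<noteq> D - {v}" using v by blast
    have "(if b then min 1 e / n else 0) \<le> 1 / n" for b and e :: real
      by (auto intro!: divide_right_mono)
    then have "?k (D - {v}) \<le> 1 / n"
      unfolding pmf_metropolis_step_neq[OF n ne] .
    moreover have "card (D - {v}) = ?q - 1" using fin v by simp
    ultimately show ?thesis
      using dec(2) unfolding F_def by (intro mult_mono) auto
  qed
  have "(\<Sum>z\<in>?S. F z) = (\<Sum>z\<in>?S. ?k z * g (card z)) - g ?q * (\<Sum>z\<in>?S. ?k z)"
    by (simp add: F_def algebra_simps sum_subtractf sum_distrib_left)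
  then have "(\<Sum>z\<in>?S. F z) = (\<Sum>z\<in>?S. ?k z * g (card z)) - g ?q"
    unfolding sum_pmf_eq_1[OF finite_cliques set_metropolis_step[OF D n]] by simp
  moreover have "(\<Sum>z\<in>?S. F z) = (\<Sum>z\<in>?N \<union> ?M. F z)"
    using M zero by (intro sum.mono_neutral_right finite_cliques) (auto simp: U_def)
  moreover have "\<dots> = (\<Sum>z\<in>?N. F z) + (\<Sum>z\<in>?M. F z)"
    using finU fin by (intro sum.union_disjoint) (auto simp: U_def)
  moreover have "(\<Sum>z\<in>?N. F z) = (\<Sum>v\<in>U. F (insert v D))"
    by (subst sum.reindex) (auto simp: inj_on_def U_def)
  moreover have "(\<Sum>z\<in>?M. F z) = (\<Sum>v\<in>D. F (D - {v}))"
    by (subst sum.reindex) (auto simp: inj_on_def)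
  moreover have "(\<Sum>v\<in>U. F (insert v D)) \<le> real (card U) * (a / n * (g (Suc ?q) - g ?q))"
    using up by (rule sum_bounded_above)
  moreover have "(\<Sum>v\<in>D. F (D - {v})) \<le> real ?q * (1 / n * (g (?q - 1) - g ?q))"
    using down by (rule sum_bounded_above)
  \<comment> \<open>Every upward move contributes a nonpositive amount, so \<open>card U\<close> may
    be replaced by the smaller number of common neighbours in \<open>E'\<close>.\<close>
  moreover have "real (card U) * (a / n * (g (Suc ?q) - g ?q)) + real ?q * (1 / n * (g (?q - 1) - g ?q)) \<le> 0"
  proof -
    have "common_neighbours n E' D \<subseteq> U"
      using insert_common_neighbour_in_cliques[OF D E'] by (auto simp: U_def)
    then have "card (common_neighbours n E' D) \<le> card U"
      using finU by (rule card_mono[rotated])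
    then have "real (card (common_neighbours n E' D)) * a * (g ?q - g (Suc ?q)) \<le> real (card U) * a * (g ?q - g (Suc ?q))"
      using a(1) dec(1) by (intro mult_right_mono) auto
    with balance have "real ?q * (g (?q - 1) - g ?q) \<le> real (card U) * a * (g ?q - g (Suc ?q))"
      by linarith
    then have "(real (card U) * a * (g (Suc ?q) - g ?q) + real ?q * (g (?q - 1) - g ?q)) / n \<le> 0"
      using n by (intro divide_nonpos_pos) (auto simp: algebra_simps)
    then show ?thesis by (simp add: add_divide_distrib)
  qed
  ultimately show ?thesis by linarith
qed

section \<open>From drift to hitting probabilities\<close>

text \<open>Degrees are controlled up to size \<open>l\<close> only. There the drift is nonpositive,
  while above \<open>l\<close> it is at most \<open>g l\<close>, which is the value of
  \<open>\<eta>\<close>. One factor \<open>T + 1\<close> comes from the union over times, the other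
  from the drift accumulated up to time \<open>T\<close>.\<close>

lemma metropolis_hit_bound:
  fixes g :: "nat \<Rightarrow> real"
  assumes n: "n > 0" and C: "C \<in> cliques n E" "card C \<le> l" and E': "E' \<subseteq> E"
    and g: "\<And>q. g q > 0" "\<And>q. q \<le> l \<Longrightarrow> g (Suc q) \<le> g q / 2"
    and a: "0 \<le> a" "a \<le> 1" "\<And>q. q \<le> l \<Longrightarrow> q < n \<Longrightarrow> a \<le> exp (\<beta> * (h (Suc q) - h q))"
    and degree: "\<And>D. D \<in> cliques n E \<Longrightarrow> 0 < card D \<Longrightarrow> card D \<le> l \<Longrightarrow>
      real (card D) * g (card D - 1) \<le> real (card (common_neighbours n E' D)) * a * g (card D) / 2"
    and B: "B \<subseteq> cliques n E"
    and M: "\<And>D. D \<in> B \<Longrightarrow> exp (\<beta> * (h (card D) - h (card C))) \<le> M"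
    and hit: "\<And>\<omega>. \<omega> 0 = C \<Longrightarrow> (\<And>t. \<omega> t \<in> cliques n E \<and> \<omega> (Suc t) \<in> set_pmf (metropolis_step n E h \<beta> (\<omega> t))) \<Longrightarrow>
      \<omega> \<in> H \<Longrightarrow> \<exists>t\<le>T. \<omega> t \<in> B"
  shows "measure (metropolis n E h \<beta> C) H \<le>
    (real T + 1)^2 * M / g (card C) * (\<Sum>D\<in>B. g (min (card D) l))"
proof -
  interpret finite_markov_chain "metropolis_step n E h \<beta>" "cliques n E" C
    by (rule finite_markov_chain_metropolis[OF n C(1)])
  \<comment> \<open>The potential is capped at \<open>Suc l\<close> rather than \<open>l\<close>, so
    that at size \<open>l\<close> an upward move still lowers it.\<close>
  let ?w = "\<lambda>D. exp (\<beta> * h (card D))" and ?V = "\<lambda>D. g (min (card D) (Suc l))"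
  have decr: "g (Suc q) \<le> g q" if "q \<le> l" for q
    using g(1)[of q] g(2)[OF that] by simp
  have drift: "(\<Sum>z\<in>cliques n E. pmf (metropolis_step n E h \<beta> D) z * ?V z) \<le> ?V D + g l"
    if D: "D \<in> cliques n E" for D
  proof (cases "card D \<le> l")
    \<comment> \<open>A step loses at most one vertex, so from size above \<open>l\<close> the
      process stays at size at least \<open>l\<close>, where the potential is at most
      \<open>g l\<close>.\<close>
    case False
    have "(\<Sum>z\<in>cliques n E. pmf (metropolis_step n E h \<beta> D) z * ?V z) \<le>
        (\<Sum>z\<in>cliques n E. pmf (metropolis_step n E h \<beta> D) z * g l)"
    proof (rule sum_mono)
      fix z assume "z \<in> cliques n E"
      show "pmf (metropolis_step n E h \<beta> D) z * ?V z \<le> pmf (metropolis_step n E h \<beta> D) z * g l"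
      proof (cases "z \<in> set_pmf (metropolis_step n E h \<beta> D)")
        case True
        then have "\<exists>v. D \<subseteq> insert v z"
          using set_pmf_metropolis_step[OF n True] by auto
        then obtain v where "D \<subseteq> insert v z" by blast
        then have "card D \<le> card (insert v z)"
          using finite_clique[OF \<open>z \<in> cliques n E\<close>] by (intro card_mono) auto
        moreover have "card (insert v z) \<le> Suc (card z)"
          using finite_clique[OF \<open>z \<in> cliques n E\<close>] by (simp add: card_insert_if)
        ultimately have "card z \<ge> l" using False by linarith
        then have "min (card z) (Suc l) = l \<or> min (card z) (Suc l) = Suc l" by auto
        then have "?V z \<le> g l" using decr[of l] by auto
        then show ?thesis by (intro mult_left_mono) auto
      qed (simp add: set_pmf_iff)
    qed
    also have "\<dots> = g l"
      using sum_pmf_eq_1[OF finite_cliques set_metropolis_step[OF D n]]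
      by (simp add: sum_distrib_right[symmetric])
    finally show ?thesis using g(1)[of "min (card D) (Suc l)"] by simp
  next
    case True
    have "card D \<le> n"
      using D card_mono[of "{..<n}" D] by (auto simp: cliques_def)
    have "(\<Sum>z\<in>cliques n E. pmf (metropolis_step n E h \<beta> D) z * ?V z) \<le> ?V D"
    proof (cases "card D < n")
      case lt: True
      show ?thesis
      proof (rule metropolis_step_drift[where g = "\<lambda>q. g (min q (Suc l))", OF n D E' a(1,2) a(3)[OF True lt]])
        show "g (min (Suc (card D)) (Suc l)) \<le> g (min (card D) (Suc l))"
          using decr[OF True] True by simp
        show dec: "g (min (card D) (Suc l)) \<le> g (min (card D - 1) (Suc l))"
          using decr[of "card D - 1"] True by (cases "card D") auto
        show "real (card D) * (g (min (card D - 1) (Suc l)) - g (min (card D) (Suc l))) \<le>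
            real (card (common_neighbours n E' D)) * a *
            (g (min (card D) (Suc l)) - g (min (Suc (card D)) (Suc l)))"
        proof (cases "card D = 0")
          case zero: True
          then show ?thesis using decr[of 0] a(1) by (auto intro!: mult_nonneg_nonneg)
        next
          case pos: False
          have "real (card D) * (g (card D - 1) - g (card D)) \<le> real (card D) * g (card D - 1)"
            using g(1)[of "card D"] by (intro mult_left_mono) auto
          also have "\<dots> \<le> real (card (common_neighbours n E' D)) * a * (g (card D) / 2)"
            using degree[OF D _ True] pos by simp
          also have "\<dots> \<le> real (card (common_neighbours n E' D)) * a * (g (card D) - g (Suc (card D)))"
            using g(2)[OF True] a(1) by (intro mult_left_mono) auto
          finally show ?thesis using True by simp
        qed
      qed
    next
      case False
      then have "card D = n" using \<open>card D \<le> n\<close> by simp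
      then have "D = {..<n}"
        using D by (intro card_subset_eq) (auto simp: cliques_def)
      then have "common_neighbours n E' D = {}" by (auto simp: common_neighbours_def)
      then have "real (card D) * g (card D - 1) \<le> 0"
        using degree[OF D _ True] n \<open>card D = n\<close> by simp
      then show ?thesis
        using n \<open>card D = n\<close> g(1)[of "card D - 1"] by (simp add: mult_le_0_iff)
    qed
    then show ?thesis using g(1)[of l] by linarith
  qed
  have "prob H \<le> (real T + 1) * (\<Sum>D\<in>B. ?w D * (?V D + real T * g l) / (?w C * ?V C))"
    by (rule prob_hit_le_drift[OF _ metropolis_step_reversible[OF n] _ drift _ B hit])
       (use g(1) in \<open>auto intro: less_imp_le\<close>)
  also have "\<dots> \<le> (real T + 1) * (\<Sum>D\<in>B. M * ((real T + 1) * g (min (card D) l)) / g (card C))"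
  proof (intro mult_left_mono sum_mono)
    fix D assume D: "D \<in> B"
    have mono: "g (Suc l) \<le> g l" "g l \<le> g (min (card D) l)"
    proof -
      have "g l \<le> g q" if "q \<le> l" for q
        using that
      proof (induction rule: inc_induct)
        case (step q)
        then show ?case using decr[of q] by simp
      qed simp
      then show "g l \<le> g (min (card D) l)" by simp
    qed (rule decr, simp)
    have V: "?V D \<le> g (min (card D) l)"
      using mono(1) le_Suc_eq[of "card D" l] by (cases "card D \<le> l") (auto simp: min_def)
    have "?w D * (?V D + real T * g l) / (?w C * ?V C) =
        exp (\<beta> * (h (card D) - h (card C))) * (?V D + real T * g l) / g (card C)"
      using C(2) by (simp add: exp_diff right_diff_distrib)
    also have "\<dots> \<le> M * ((real T + 1) * g (min (card D) l)) / g (card C)"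
    proof (intro divide_right_mono mult_mono)
      show "exp (\<beta> * (h (card D) - h (card C))) \<le> M" using M[OF D] .
      then show "0 \<le> M" using exp_ge_zero order_trans by blast
      show "?V D + real T * g l \<le> (real T + 1) * g (min (card D) l)"
        using V mult_left_mono[OF mono(2), of "real T"] by (simp add: algebra_simps)
      show "0 \<le> ?V D + real T * g l" using g(1) by (simp add: less_imp_le)
    qed (use g(1)[of "card C"] in simp)
    finally show "?w D * (?V D + real T * g l) / (?w C * ?V C) \<le> M * ((real T + 1) * g (min (card D) l)) / g (card C)" .
  qed simp
  also have "\<dots> = (real T + 1)^2 * M / g (card C) * (\<Sum>D\<in>B. g (min (card D) l))"
    by (simp add: sum_distrib_left sum_divide_distrib power2_eq_square mult_ac)
  finally show ?thesis by (simp add: metropolis_def)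
qed

text \<open>The possible exit states from the region \<open>card D < m\<close>,
  \<open>card (D \<inter> P) < r\<close>. Subsets of the planted clique are cliques outright, which
  is why the overlap is capped besides the size.\<close>

definition boundary_cliques :: "nat \<Rightarrow> nat set set \<Rightarrow> nat set \<Rightarrow> nat \<Rightarrow> nat \<Rightarrow> nat set set" where
  "boundary_cliques n E P m r =
     {D \<in> cliques n E. card D \<le> m \<and> card (D \<inter> P) \<le> r \<and> (card D = m \<or> card (D \<inter> P) = r)}"

text \<open>A step adds at most one vertex, so neither \<open>m\<close> nor \<open>r\<close> can be
  jumped over.\<close>

lemma exit_through_boundary:
  assumes n: "n > 0"
    and path: "\<And>t. \<omega> t \<in> cliques n E \<and> \<omega> (Suc t) \<in> set_pmf (metropolis_step n E h \<beta> (\<omega> t))"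
    and start: "card (\<omega> 0) < m" "card (\<omega> 0 \<inter> P) < r"
    and large: "m \<le> card (\<omega> t)"
  shows "\<exists>i\<le>t. \<omega> i \<in> boundary_cliques n E P m r"
proof -
  have "(\<exists>i\<le>t. \<omega> i \<in> boundary_cliques n E P m r) \<or> (card (\<omega> t) < m \<and> card (\<omega> t \<inter> P) < r)" for t
  proof (induction t)
    case 0
    then show ?case using start by simp
  next
    case (Suc t)
    show ?case
    proof (cases "\<exists>i\<le>t. \<omega> i \<in> boundary_cliques n E P m r")
      case True
      then show ?thesis using le_SucI by blast
    next
      case False
      with Suc have lt: "card (\<omega> t) < m" "card (\<omega> t \<inter> P) < r" by auto
      have fin: "finite (\<omega> t)" using path finite_clique by blast
      have "\<exists>v. \<omega> (Suc t) \<subseteq> insert v (\<omega> t)"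
        using set_pmf_metropolis_step[OF n, of "\<omega> (Suc t)" E h \<beta> "\<omega> t"] path[of t] by auto
      then obtain v where v: "\<omega> (Suc t) \<subseteq> insert v (\<omega> t)" by blast
      have "card (\<omega> (Suc t)) \<le> card (insert v (\<omega> t))"
        using v fin by (intro card_mono) auto
      moreover have "card (\<omega> (Suc t) \<inter> P) \<le> card (insert v (\<omega> t \<inter> P))"
        using v fin by (intro card_mono) auto
      ultimately have "card (\<omega> (Suc t)) \<le> m" "card (\<omega> (Suc t) \<inter> P) \<le> r"
        using lt fin card_insert_le_m1[of "card (\<omega> t)" "\<omega> t" v]
        by (auto simp: card_insert_if split: if_splits)
      then show ?thesis
        using path[of "Suc t"] by (force simp: boundary_cliques_def le_less)
    qed
  qed
  then show ?thesis using large by (metis not_less)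
qed

section \<open>Counting boundary cliques\<close>

lemma real_choose_two: "real (q choose 2) = real q * (real q - 1) / 2"
proof -
  have "even (q * (q - 1))" by (cases q) auto
  then show ?thesis
    by (cases q) (auto simp: choose_two real_of_nat_div algebra_simps)
qed

lemma finite_set_pmf_gnp_half: "finite (set_pmf (gnp_half n))"
  unfolding gnp_half_conv_pmf_of_set
  by (subst set_pmf_of_set) (auto simp: finite_imp_finite_nsets)

text \<open>Markov's inequality for the weighted number of boundary cliques. The expectation is
  split into classes of size \<open>q\<close> and overlap \<open>s\<close>, at most
  \<open>(m + 1) * (r + 1)\<close> of them.\<close>

lemma prob_boundary_weight:
  fixes f :: "nat \<Rightarrow> real"
  assumes P: "P \<subseteq> {..<n}" and f: "\<And>q. f q \<ge> 0" and c: "c > 0"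
    and bound: "\<And>q s. s \<le> q \<Longrightarrow> q \<le> m \<Longrightarrow> s \<le> r \<Longrightarrow> q = m \<or> s = r \<Longrightarrow>
      real (card P) ^ s * real n ^ (q - s) / 2 ^ ((q choose 2) - (s choose 2)) * f q \<le> \<rho>"
    and rho: "\<rho> \<ge> 0"
  shows "measure_pmf.prob (gnp_half n)
      {E. c \<le> (\<Sum>D\<in>boundary_cliques n (E \<union> nsets P 2) P m r. f (card D))} \<le>
    (real m + 1) * (real r + 1) * \<rho> / c"
proof -
  define I where "I = {(q, s). s \<le> q \<and> q \<le> m \<and> s \<le> r \<and> (q = m \<or> s = r)}"
  define Ds where "Ds = (\<lambda>(q, s). {D. D \<subseteq> {..<n} \<and> card D = q \<and> card (D \<inter> P) = s})"
  let ?S = "Sigma I Ds"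
  let ?A = "\<lambda>D. {E. clique D (E \<union> nsets P 2)}"
  let ?W = "\<lambda>E. \<Sum>D\<in>boundary_cliques n (E \<union> nsets P 2) P m r. f (card D)"
  have I: "I \<subseteq> {..m} \<times> {..r}" by (auto simp: I_def)
  then have finI: "finite I" by (rule finite_subset) auto
  have finDs: "finite (Ds p)" for p
    by (rule finite_subset[of _ "Pow {..<n}"]) (auto simp: Ds_def split: prod.splits)
  have fin: "finite ?S" using finI finDs by (intro finite_SigmaI)
  \<comment> \<open>The random index set is exchanged for indicators over a fixed one, so that
    expectations can be taken term by term.\<close>
  have W: "?W E = (\<Sum>x\<in>?S. f (card (snd x)) * indicator (?A (snd x)) E)" for E
  proof -
    let ?T = "{x \<in> ?S. clique (snd x) (E \<union> nsets P 2)}"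
    have inj: "inj_on snd ?S"
      by (auto simp: inj_on_def Ds_def)
    have "boundary_cliques n (E \<union> nsets P 2) P m r = snd ` ?T"
    proof (intro equalityI subsetI)
      fix D assume D: "D \<in> boundary_cliques n (E \<union> nsets P 2) P m r"
      then have "finite D" by (auto simp: boundary_cliques_def dest: finite_clique)
      then have "card (D \<inter> P) \<le> card D" by (intro card_mono) auto
      with D have "((card D, card (D \<inter> P)), D) \<in> ?T"
        by (auto simp: boundary_cliques_def cliques_def I_def Ds_def)
      then show "D \<in> snd ` ?T" by (rule image_eqI[rotated]) simp
    next
      fix D assume "D \<in> snd ` ?T"
      then show "D \<in> boundary_cliques n (E \<union> nsets P 2) P m r"
        by (auto simp: boundary_cliques_def cliques_def I_def Ds_def)
    qed
    then have "?W E = (\<Sum>x\<in>?T. f (card (snd x)))"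
      using inj_on_subset[OF inj, of ?T] by (simp add: sum.reindex)
    also have "\<dots> = (\<Sum>x\<in>?S. f (card (snd x)) * indicator (?A (snd x)) E)"
      using fin by (intro sum.mono_neutral_cong_left) (auto simp: indicator_def)
    finally show ?thesis .
  qed
  have "measure_pmf.prob (gnp_half n) {E. c \<le> ?W E} =
      measure_pmf.prob (gnp_half n) {E \<in> space (measure_pmf (gnp_half n)). ?W E \<ge> c}"
    by simp
  also have "\<dots> \<le> measure_pmf.expectation (gnp_half n) ?W / c"
    using c f finite_set_pmf_gnp_half
    by (intro integral_Markov_inequality_measure[where A = "{}"] integrable_measure_pmf_finite)
       (auto intro: sum_nonneg)
  also have "measure_pmf.expectation (gnp_half n) ?W =
      (\<Sum>x\<in>?S. f (card (snd x)) * measure_pmf.prob (gnp_half n) (?A (snd x)))"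
    unfolding W using finite_set_pmf_gnp_half
    by (subst Bochner_Integration.integral_sum) (auto intro: integrable_measure_pmf_finite)
  also have "\<dots> = (\<Sum>p\<in>I. \<Sum>D\<in>Ds p. f (card D) * measure_pmf.prob (gnp_half n) (?A D))"
    using finI finDs by (subst sum.Sigma) (auto simp: case_prod_unfold)
  also have "\<dots> \<le> (\<Sum>p\<in>I. \<rho>)"
  proof (rule sum_mono)
    fix p assume p: "p \<in> I"
    obtain q s where qs: "p = (q, s)" by (rule prod.exhaust)
    have I': "s \<le> q" "q \<le> m" "s \<le> r" "q = m \<or> s = r" using p by (auto simp: I_def qs)
    have "(\<Sum>D\<in>Ds p. f (card D) * measure_pmf.prob (gnp_half n) (?A D)) =
        (\<Sum>D\<in>Ds p. f q * (1 / 2 ^ ((q choose 2) - (s choose 2))))"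
      by (intro sum.cong refl) (auto simp: Ds_def qs prob_clique_planted)
    also have "\<dots> = real (card (Ds p)) * (f q * (1 / 2 ^ ((q choose 2) - (s choose 2))))"
      by simp
    also have "\<dots> \<le> real (card P ^ s * n ^ (q - s)) * (f q * (1 / 2 ^ ((q choose 2) - (s choose 2))))"
      using card_subsets_meeting[OF _ P I'(1)] f
      by (intro mult_right_mono) (auto simp: Ds_def qs simp del: of_nat_mult)
    also have "\<dots> \<le> \<rho>"
      using bound[OF I'] by (simp add: mult_ac)
    finally show "(\<Sum>D\<in>Ds p. f (card D) * measure_pmf.prob (gnp_half n) (?A D)) \<le> \<rho>" .
  qed
  also have "\<dots> \<le> (real m + 1) * (real r + 1) * \<rho>"
  proof -
    have "real (card I) \<le> real (card ({..m} \<times> {..r}))"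
      using I by (intro of_nat_mono card_mono) auto
    also have "\<dots> = (real m + 1) * (real r + 1)"
      by (simp add: card_cartesian_product algebra_simps)
    finally show ?thesis using rho by (simp add: mult_right_mono)
  qed
  finally show ?thesis using c by (simp add: divide_right_mono)
qed

text \<open>Union bound over all vertex sets of size at most \<open>l\<close>. Cliques of
  \<open>E\<close> alone would not suffice, because planting creates new ones.\<close>

lemma prob_degree_failure:
  fixes y :: "nat \<Rightarrow> real"
  assumes n: "n > 0" and l: "l \<le> n" and \<rho>: "\<rho> \<ge> 0"
    and bound: "\<And>q. q \<le> l \<Longrightarrow> nat \<lceil>y q\<rceil> \<le> n \<and> q + nat \<lceil>y q\<rceil> \<le> n \<and>
      real n ^ nat \<lceil>y q\<rceil> * exp (- (real n - real q - real (nat \<lceil>y q\<rceil>)) / 2 ^ q) \<le> \<rho>"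
  shows "measure_pmf.prob (gnp_half n)
      {E. \<exists>C\<subseteq>{..<n}. card C \<le> l \<and> real (card (common_neighbours n E C)) < y (card C)} \<le>
    (real l + 1) * real n ^ l * \<rho>"
proof -
  define Cs where "Cs q = {C. C \<subseteq> {..<n} \<and> card C = q}" for q
  let ?A = "\<lambda>C. {E. card (common_neighbours n E C) \<le> nat \<lceil>y (card C)\<rceil>}"
  have finCs: "finite (Cs q)" for q
    by (rule finite_subset[of _ "Pow {..<n}"]) (auto simp: Cs_def)
  have fin: "finite (\<Union>q\<le>l. Cs q)" using finCs by auto
  have "measure_pmf.prob (gnp_half n)
      {E. \<exists>C\<subseteq>{..<n}. card C \<le> l \<and> real (card (common_neighbours n E C)) < y (card C)} \<le>
      measure_pmf.prob (gnp_half n) (\<Union>C\<in>(\<Union>q\<le>l. Cs q). ?A C)"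
  proof (intro measure_pmf.finite_measure_mono subsetI)
    fix E assume "E \<in> {E. \<exists>C\<subseteq>{..<n}. card C \<le> l \<and> real (card (common_neighbours n E C)) < y (card C)}"
    then obtain C where C: "C \<subseteq> {..<n}" "card C \<le> l" "real (card (common_neighbours n E C)) < y (card C)"
      by blast
    then have "card (common_neighbours n E C) \<le> nat \<lceil>y (card C)\<rceil>" by linarith
    with C show "E \<in> (\<Union>C\<in>(\<Union>q\<le>l. Cs q). ?A C)" by (auto simp: Cs_def)
  qed auto
  also have "\<dots> \<le> (\<Sum>C\<in>(\<Union>q\<le>l. Cs q). measure_pmf.prob (gnp_half n) (?A C))"
    using fin by (intro measure_pmf.finite_measure_subadditive_finite) auto
  also have "\<dots> = (\<Sum>q\<le>l. \<Sum>C\<in>Cs q. measure_pmf.prob (gnp_half n) (?A C))"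
    using finCs by (intro sum.UNION_disjoint) (auto simp: Cs_def)
  also have "\<dots> \<le> (\<Sum>q\<le>l. real n ^ l * \<rho>)"
  proof (intro sum_mono)
    fix q assume "q \<in> {..l}"
    then have q: "q \<le> l" by simp
    have "(\<Sum>C\<in>Cs q. measure_pmf.prob (gnp_half n) (?A C)) \<le> (\<Sum>C\<in>Cs q. \<rho>)"
    proof (rule sum_mono)
      fix C assume "C \<in> Cs q"
      then have C: "C \<subseteq> {..<n}" "card C = q" by (auto simp: Cs_def)
      show "measure_pmf.prob (gnp_half n) (?A C) \<le> \<rho>"
        using prob_few_common_neighbours[OF C(1), of "nat \<lceil>y q\<rceil>"] bound[OF q] C(2) by simp
    qed
    also have "\<dots> = real (n choose q) * \<rho>"
      by (simp add: Cs_def n_subsets)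
    also have "\<dots> \<le> real n ^ l * \<rho>"
    proof (intro mult_right_mono \<rho>)
      have "n choose q \<le> n ^ q" using q l by (intro binomial_le_pow) simp
      also have "\<dots> \<le> n ^ l" using q n by (intro power_increasing) auto
      finally show "real (n choose q) \<le> real n ^ l" by (simp flip: of_nat_power)
    qed
    finally show "(\<Sum>C\<in>Cs q. measure_pmf.prob (gnp_half n) (?A C)) \<le> real n ^ l * \<rho>" .
  qed
  finally show ?thesis by (simp add: algebra_simps)
qed

section \<open>Exponent of the expected boundary weight\<close>

text \<open>The left side is the binary logarithm of a bound on the expected weight of a class. It
  splits as \<open>A + B\<close> with \<open>A\<close> the effect of the overlap \<open>s\<close>
  and \<open>B\<close> that of the size \<open>q\<close>. Since
  \<open>s - 1 \<le> (1 - \<alpha>) / 2 * L\<close>, \<open>A\<close> is at most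
  \<open>- (3 / 4) * s * (1 - \<alpha>) * L\<close>, hence never positive and of order
  \<open>- L^2\<close> at \<open>s = r\<close>.\<close>

lemma boundary_exponent_le:
  fixes L q s l m r \<omega> \<alpha> \<epsilon> \<theta> :: real
  assumes par: "0 < \<omega>" "\<omega> \<le> \<epsilon>" "\<omega> \<le> 1 - \<alpha>" "\<epsilon> < 1" "\<theta> \<ge> 0" "L \<ge> 1"
    and qs: "0 \<le> s" "s \<le> q" "q \<le> m" "s \<le> r" "q = m \<or> s = r"
    and l: "0 \<le> l" "l \<le> (1 - \<omega> / 2) * L" "(1 - \<omega> / 2) * L \<le> l + 1"
    and m: "(1 + \<epsilon>) * L \<le> m" "m \<le> (1 + \<epsilon>) * L + 1"
    and r: "(1 - \<alpha>) / 2 * L \<le> r" "r \<le> (1 - \<alpha>) / 2 * L + 1"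
  shows "s * (\<alpha> * L) + (q - s) * L - (q * (q - 1) / 2 - s * (s - 1) / 2) +
      (- (1 - 2 * \<theta>) * L * min q l + min q l * (min q l + 1) / 2) \<le>
    - \<omega>\<^sup>2 / 4 * L\<^sup>2 + 2 * \<theta> * L\<^sup>2 + 2 * L + 1"
proof -
  define A where "A = s * (s - 1) / 2 - s * (1 - \<alpha>) * L"
  define B where "B = q * L - q * (q - 1) / 2 - (1 - 2 * \<theta>) * L * min q l + min q l * (min q l + 1) / 2"
  have pos: "L > 0" "1 - \<alpha> > 0" using par by auto
  have \<omega>L: "0 \<le> \<omega> * L" using par by simp
  have lL: "l \<le> L"
    using l(2) \<omega>L by (simp add: algebra_simps)
  have s1: "s - 1 \<le> (1 - \<alpha>) / 2 * L" using qs r by linarith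
  have "s * (s - 1) \<le> s * ((1 - \<alpha>) / 2 * L)" using s1 qs(1) by (rule mult_left_mono)
  then have A1: "A \<le> - (3 / 4) * (s * ((1 - \<alpha>) * L))"
    by (simp add: A_def field_simps)
  have A0: "A \<le> 0"
    using A1 mult_nonneg_nonneg[OF qs(1), of "(1 - \<alpha>) * L"] pos by simp
  have Ar: "A \<le> - (3 / 8) * (\<omega> * L)\<^sup>2" if "s = r"
  proof -
    have "\<omega> * L \<le> (1 - \<alpha>) * L" using par pos by (intro mult_right_mono) auto
    from mult_mono'[OF this this \<omega>L \<omega>L]
    have "(\<omega> * L) * (\<omega> * L) \<le> ((1 - \<alpha>) * L) * ((1 - \<alpha>) * L)" .
    also have "\<dots> \<le> 2 * r * ((1 - \<alpha>) * L)" using r(1) pos by (intro mult_right_mono) auto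
    finally have "(\<omega> * L) * (\<omega> * L) \<le> 2 * (s * ((1 - \<alpha>) * L))" using that by simp
    then show ?thesis using A1 unfolding power2_eq_square by linarith
  qed
  have sq: "(\<omega> * L)\<^sup>2 \<ge> 0" by simp
  have \<theta>L: "2 * \<theta> * L * x \<le> 2 * \<theta> * L\<^sup>2" if "x \<le> L" for x
    using mult_left_mono[OF that, of "2 * \<theta> * L"] par pos by (simp add: power2_eq_square mult_ac)
  have "A + B \<le> - (1 / 4) * (\<omega> * L)\<^sup>2 + 2 * \<theta> * L\<^sup>2 + 2 * L + 1"
  proof (cases "q \<le> l")
    case True
    \<comment> \<open>Up to \<open>l\<close> the count and the weight cancel to lower order, so the
      decay has to come from the overlap: \<open>q < m\<close> forces \<open>s = r\<close>.\<close>
    have B: "B = q + 2 * \<theta> * L * q"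
      using True by (simp add: B_def min_def field_simps)
    have "\<epsilon> * L > 0" using par pos by (intro mult_pos_pos) linarith+
    then have "q < m"
      using True lL m(1) by (simp add: algebra_simps)
    then have "s = r" using qs by auto
    then show ?thesis using Ar B \<theta>L[of q] True lL sq pos by linarith
  next
    case False
    \<comment> \<open>Beyond \<open>l\<close> the main term of \<open>B\<close> is
      \<open>((L - l)^2 - (q - L)^2) / 2\<close>. The first square is about
      \<open>(\<omega> * L)^2 / 4\<close>, and for \<open>q = m\<close> the second is at least
      \<open>(\<omega> * L)^2\<close>.\<close>
    then have "min q l = l" by (simp add: min_def)
    then have B: "B = ((L - l)\<^sup>2 - (q - L)\<^sup>2) / 2 + (q + l) / 2 + 2 * \<theta> * L * l"
      unfolding B_def by (simp add: power2_eq_square field_simps)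
    have "\<epsilon> * L \<le> L" using par pos by simp
    then have "q \<le> 2 * L + 1" using qs(3) m(2) by (simp add: algebra_simps)
    have "\<omega> * L \<le> \<epsilon> * L" using par pos by (intro mult_right_mono) auto
    have "(L - l)\<^sup>2 \<le> (\<omega> * L / 2 + 1)\<^sup>2"
      using l(3) lL by (intro power_mono) (auto simp: algebra_simps)
    then have Ll: "(L - l)\<^sup>2 \<le> (\<omega> * L)\<^sup>2 / 4 + \<omega> * L + 1"
      by (simp add: power2_eq_square field_simps)
    have "(q - L)\<^sup>2 \<ge> (\<omega> * L)\<^sup>2" if "q = m"
      using \<omega>L m(1) that \<open>\<omega> * L \<le> \<epsilon> * L\<close> by (intro power_mono) (auto simp: algebra_simps)
    then have "A - (q - L)\<^sup>2 / 2 \<le> - (3 / 8) * (\<omega> * L)\<^sup>2"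
    proof (cases "q = m")
      case True
      then show ?thesis using \<open>q = m \<Longrightarrow> (\<omega> * L)\<^sup>2 \<le> (q - L)\<^sup>2\<close> A0 sq by linarith
    next
      case False
      then show ?thesis using Ar qs(5) zero_le_power2[of "q - L"] by linarith
    qed
    moreover have "\<omega> * L \<le> L" using \<open>\<omega> * L \<le> \<epsilon> * L\<close> \<open>\<epsilon> * L \<le> L\<close> by simp
    \<comment> \<open>Squares and products are generalised to variables, leaving a linear
      problem.\<close>
    moreover have "x + y \<le> - (1 / 4) * w + t + 2 * L + 1"
      if "x - v / 2 \<le> - (3 / 8) * w" "w' \<le> L" "y = (u - v) / 2 + (q + l) / 2 + t'"
        "u \<le> w / 4 + w' + 1" "t' \<le> t" for x y w w' u v t t'
      using that \<open>q \<le> 2 * L + 1\<close> lL by (simp add: field_simps)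
    ultimately show ?thesis
      using B Ll \<theta>L[OF lL] by blast
  qed
  then show ?thesis
    by (simp add: A_def B_def algebra_simps power_mult_distrib)
qed

section \<open>Slow mixing at a fixed size\<close>

text \<open>
  The birth-death weight \<open>(K / n)\<^bsup>q\<^esup> 2\<^bsup>q (q + 1) / 2\<^esup>\<close> with \<open>K = n\<^bsup>2 \<theta>\<^esup>\<close> and \<open>L = log 2 n\<close>; the factor \<open>K\<close>
  absorbs the logarithmic losses in the degrees and the Metropolis acceptance probabilities.
\<close>

definition level_weight :: "real \<Rightarrow> real \<Rightarrow> nat \<Rightarrow> real" where
  "level_weight \<theta> L q = 2 powr (- (1 - 2 * \<theta>) * L * real q + real q * (real q + 1) / 2)"

lemma level_weight_pos: "level_weight \<theta> L q > 0"
  by (simp add: level_weight_def)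

lemma level_weight_Suc:
  "level_weight \<theta> L (Suc q) = level_weight \<theta> L q * 2 powr (real q + 1 - (1 - 2 * \<theta>) * L)"
  unfolding level_weight_def powr_add[symmetric] by (intro arg_cong[where f = "(powr) 2"]) (simp add: field_simps)

text \<open>The graph and the planted set are drawn independently, so the order of sampling can be
  exchanged and a bound uniform in \<open>P\<close> suffices.\<close>

lemma measure_planted_clique_ge:
  assumes k: "k \<le> n"
    and bound: "\<And>P. P \<subseteq> {..<n} \<Longrightarrow> card P = k \<Longrightarrow> measure_pmf.prob (gnp_half n) {E. \<not> Q (E \<union> nsets P 2)} \<le> \<delta>"
  shows "measure_pmf.prob (planted_clique n k) {E. Q E} \<ge> 1 - \<delta>"
proof -
  let ?Ps = "{S. S \<subseteq> {..<n} \<and> card S = k}"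
  let ?f = "\<lambda>P. bind_pmf (gnp_half n) (\<lambda>E. return_pmf (E \<union> nsets P 2))"
  have fin: "finite ?Ps" by (rule finite_subset[of _ "Pow {..<n}"]) auto
  have ne: "?Ps \<noteq> {}" using k by (auto intro!: exI[of _ "{..<k}"])
  have "planted_clique n k = bind_pmf (pmf_of_set ?Ps) ?f"
    unfolding planted_clique_def by (rule bind_commute_pmf)
  then have "emeasure (planted_clique n k) {E. \<not> Q E} = (\<integral>\<^sup>+P. emeasure (?f P) {E. \<not> Q E} \<partial>pmf_of_set ?Ps)"
    by simp
  also have "\<dots> \<le> (\<integral>\<^sup>+P. ennreal \<delta> \<partial>pmf_of_set ?Ps)"
  proof (intro nn_integral_mono_AE, rule AE_pmfI)
    fix P assume "P \<in> set_pmf (pmf_of_set ?Ps)"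
    then have P: "P \<subseteq> {..<n}" "card P = k" using fin ne by auto
    have "emeasure (?f P) {E. \<not> Q E} = emeasure (gnp_half n) {E. \<not> Q (E \<union> nsets P 2)}"
      by (simp add: map_pmf_def[symmetric] vimage_def)
    also have "\<dots> \<le> ennreal \<delta>"
      using bound[OF P] by (simp add: measure_pmf.emeasure_eq_measure ennreal_leI)
    finally show "emeasure (?f P) {E. \<not> Q E} \<le> ennreal \<delta>" .
  qed
  also have "\<dots> = ennreal \<delta>"
    by simp
  finally have "measure_pmf.prob (planted_clique n k) {E. \<not> Q E} \<le> \<delta>"
    \<comment> \<open>Leaving \<open>ennreal\<close> requires \<open>\<delta> \<ge> 0\<close>, which
      \<open>bound\<close> yields at a concrete planted set.\<close>
    using order_trans[OF measure_nonneg bound[of "{..<k}"]] k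
    by (simp add: measure_pmf.emeasure_eq_measure)
  moreover have "measure_pmf.prob (planted_clique n k) {E. \<not> Q E} = 1 - measure_pmf.prob (planted_clique n k) {E. Q E}"
    using measure_pmf.prob_compl[of "{E. Q E}" "planted_clique n k"]
    by (simp add: Collect_neg_eq Compl_eq_Diff_UNIV)
  ultimately show ?thesis by simp
qed

text \<open>The summands bound the failure of \<open>large_degrees\<close> and of
  \<open>small_weight\<close>. The factor \<open>2 powr (L\<^sup>2)\<close> is
  \<open>n powr L\<close>, a bound on the number of vertex sets of one size.\<close>

definition failure_bound :: "real \<Rightarrow> real \<Rightarrow> real \<Rightarrow> real" where
  "failure_bound \<omega> \<theta> L = (L + 1) * 2 powr (L\<^sup>2) * 2 powr (L - 2 powr (\<omega> / 2 * L) / 4) +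
     (2 * L + 2)\<^sup>2 * 2 powr (- \<omega>\<^sup>2 / 4 * L\<^sup>2 + 2 * \<theta> * L\<^sup>2 + 2 * L + 1 + \<omega>\<^sup>2 / 8 * L\<^sup>2)"

section \<open>Estimates for a fixed large \<open>n\<close>\<close>

text \<open>At size \<open>l\<close> about \<open>n powr (\<omega> / 2)\<close> extensions remain.
  The overlap \<open>r\<close> is half of \<open>(1 - \<alpha>) * L\<close>, where the planted part
  of the exponent is minimal. The assumptions from \<open>L_ge\<close> on hold for large
  \<open>n\<close>: \<open>acceptance\<close> pays for all losses in the drift balance,
  \<open>slack\<close> for the constant in the final exponent.\<close>

locale planted_instance =
  fixes \<alpha> \<epsilon> \<omega> \<theta> L :: real and n l m r :: nat
  assumes params: "0 \<le> \<alpha>" "\<alpha> < 1" "0 < \<epsilon>" "\<epsilon> < 1"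
    and \<omega>_eq: "\<omega> = min \<epsilon> (1 - \<alpha>)" and \<theta>_eq: "\<theta> = \<omega>\<^sup>2 / 256" and L_eq: "L = log 2 (real n)"
    and l_eq: "l = nat \<lfloor>(1 - \<omega> / 2) * L\<rfloor>" and m_eq: "m = nat \<lceil>(1 + \<epsilon>) * L\<rceil>"
    and r_eq: "r = nat \<lceil>(1 - \<alpha>) / 2 * L\<rceil>"
    and L_ge: "L \<ge> 10"
    and acceptance: "8 * L\<^sup>2 \<le> exp (- \<theta> * L) * 2 powr (2 * \<theta> * L)"
    and halving: "(1 - \<omega> / 2) * L + 2 \<le> (1 - 2 * \<theta>) * L"
    and slack: "2 \<le> \<omega>\<^sup>2 * L\<^sup>2 / 32"
    and L_le: "L + 1 \<le> real n / 4"
begin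

lemma \<omega>_bounds: "0 < \<omega>" "\<omega> \<le> \<epsilon>" "\<omega> \<le> 1 - \<alpha>" "\<omega> < 1"
  using params by (auto simp: \<omega>_eq)

lemma \<theta>_pos: "\<theta> > 0"
  using \<omega>_bounds by (simp add: \<theta>_eq)

lemma n_pos: "n > 0"
  using L_le L_ge by (cases n) auto

lemma n_eq: "real n = 2 powr L"
  using n_pos by (simp add: L_eq)

lemma n_powr: "real n powr x = 2 powr (L * x)"
  by (simp add: n_eq powr_powr)

lemma n_power: "real n ^ j = 2 powr (L * real j)"
  using n_pos by (simp add: powr_realpow[symmetric] n_powr)

lemma l_bounds: "real l \<le> (1 - \<omega> / 2) * L" "(1 - \<omega> / 2) * L \<le> real l + 1"
proof -
  have "(1 - \<omega> / 2) * L \<ge> 0" using \<omega>_bounds L_ge by (intro mult_nonneg_nonneg) auto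
  then show "real l \<le> (1 - \<omega> / 2) * L" "(1 - \<omega> / 2) * L \<le> real l + 1"
    unfolding l_eq by linarith+
qed

lemma m_bounds: "(1 + \<epsilon>) * L \<le> real m" "real m \<le> (1 + \<epsilon>) * L + 1"
proof -
  have "(1 + \<epsilon>) * L \<ge> 0" using params L_ge by (intro mult_nonneg_nonneg) auto
  then show "(1 + \<epsilon>) * L \<le> real m" "real m \<le> (1 + \<epsilon>) * L + 1"
    unfolding m_eq by linarith+
qed

lemma r_bounds: "(1 - \<alpha>) / 2 * L \<le> real r" "real r \<le> (1 - \<alpha>) / 2 * L + 1"
proof -
  have "(1 - \<alpha>) / 2 * L \<ge> 0" using params L_ge by (intro mult_nonneg_nonneg) auto
  then show "(1 - \<alpha>) / 2 * L \<le> real r" "real r \<le> (1 - \<alpha>) / 2 * L + 1"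
    unfolding r_eq by linarith+
qed

lemma l_le: "real l \<le> L" "l \<le> n"
proof -
  have "\<omega> * L \<ge> 0" using \<omega>_bounds L_ge by simp
  then show "real l \<le> L" using l_bounds(1) by (simp add: algebra_simps)
  then show "l \<le> n" using L_le L_ge by linarith
qed

text \<open>\<open>L \<ge> 10\<close> places every size up to \<open>m\<close> in the range of the
  Lipschitz condition.\<close>

lemma m_le: "real m \<le> 2.1 * L" "real m \<le> 2 * L + 1"
proof -
  have "\<epsilon> * L \<le> L" using params L_ge by simp
  then show "real m \<le> 2 * L + 1" using m_bounds(2) by (simp add: algebra_simps)
  then show "real m \<le> 2.1 * L" using L_ge by linarith
qed

lemma r_le: "real r \<le> L / 2 + 1"
proof -
  have "\<alpha> * L \<ge> 0" using params L_ge by simp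
  then show ?thesis using r_bounds(2) by (simp add: field_simps)
qed

lemma boundary_term_le:
  assumes P: "real (card P) \<le> real n powr \<alpha>"
    and qs: "s \<le> q" "q \<le> m" "s \<le> r" "q = m \<or> s = r"
  shows "real (card P) ^ s * real n ^ (q - s) / 2 ^ ((q choose 2) - (s choose 2)) * level_weight \<theta> L (min q l) \<le>
    2 powr (- \<omega>\<^sup>2 / 4 * L\<^sup>2 + 2 * \<theta> * L\<^sup>2 + 2 * L + 1)"
proof -
  have "real (card P) ^ s \<le> (real n powr \<alpha>) ^ s"
    using P by (intro power_mono) auto
  also have "\<dots> = 2 powr (real s * (\<alpha> * L))"
    using n_pos by (simp add: powr_realpow[symmetric] n_powr powr_powr mult_ac)
  finally have 1: "real (card P) ^ s \<le> 2 powr (real s * (\<alpha> * L))" .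
  have 2: "real n ^ (q - s) = 2 powr ((real q - real s) * L)"
    using qs(1) by (simp add: n_power of_nat_diff mult.commute)
  have "s choose 2 \<le> q choose 2" using qs(1) by (rule binomial_right_mono)
  then have 3: "1 / 2 ^ ((q choose 2) - (s choose 2)) =
      2 powr (- (real q * (real q - 1) / 2 - real s * (real s - 1) / 2))"
    by (simp only: powr_realpow[symmetric] zero_less_numeral of_nat_diff real_choose_two powr_minus_divide)
  have "real (card P) ^ s * real n ^ (q - s) / 2 ^ ((q choose 2) - (s choose 2)) * level_weight \<theta> L (min q l) =
      real (card P) ^ s * (real n ^ (q - s) * (1 / 2 ^ ((q choose 2) - (s choose 2))) * level_weight \<theta> L (min q l))"
    by simp
  also have "\<dots> \<le> 2 powr (real s * (\<alpha> * L)) *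
      (real n ^ (q - s) * (1 / 2 ^ ((q choose 2) - (s choose 2))) * level_weight \<theta> L (min q l))"
    using 1 level_weight_pos[of \<theta> L "min q l"] by (intro mult_right_mono) auto
  also have "\<dots> = 2 powr (real s * (\<alpha> * L) + (real q - real s) * L -
      (real q * (real q - 1) / 2 - real s * (real s - 1) / 2) +
      (- (1 - 2 * \<theta>) * L * min (real q) (real l) + min (real q) (real l) * (min (real q) (real l) + 1) / 2))"
    unfolding 2 3 level_weight_def powr_add[symmetric] of_nat_min
    by (rule arg_cong[where f = "(powr) 2"]) linarith
  also have "\<dots> \<le> 2 powr (- \<omega>\<^sup>2 / 4 * L\<^sup>2 + 2 * \<theta> * L\<^sup>2 + 2 * L + 1)"
    using qs \<omega>_bounds params \<theta>_pos L_ge l_bounds m_bounds r_bounds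
    by (intro powr_mono boundary_exponent_le[where \<epsilon> = \<epsilon> and m = "real m" and r = "real r"]) auto
  finally show ?thesis .
qed

text \<open>The threshold has half the exponent \<open>\<omega>\<^sup>2 / 4\<close> of the expected
  weight; Markov's inequality turns the other half, up to lower losses, into failure
  probability.\<close>

definition small_weight :: "nat set set \<Rightarrow> nat set \<Rightarrow> bool" where
  "small_weight E P \<longleftrightarrow> (\<Sum>D\<in>boundary_cliques n E P m r. level_weight \<theta> L (min (card D) l)) < 2 powr (- \<omega>\<^sup>2 / 8 * L\<^sup>2)"

text \<open>The mean is about \<open>n / 2 ^ card C\<close>. Giving up a factor \<open>4 * L\<close>
  keeps the number \<open>n ^ j\<close> of covering sets near \<open>2\<close> to a quarter of the
  mean, against a probability of at most \<open>2\<close> to minus half the mean.\<close>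

definition large_degrees :: "nat set set \<Rightarrow> bool" where
  "large_degrees E \<longleftrightarrow> (\<forall>C\<subseteq>{..<n}. card C \<le> l \<longrightarrow>
     real n / (2 ^ card C * (4 * L)) \<le> real (card (common_neighbours n E C)))"

lemma prob_not_small_weight:
  assumes P: "P \<subseteq> {..<n}" "real (card P) \<le> real n powr \<alpha>"
  shows "measure_pmf.prob (gnp_half n) {E. \<not> small_weight (E \<union> nsets P 2) P} \<le>
    (2 * L + 2)\<^sup>2 * 2 powr (- \<omega>\<^sup>2 / 4 * L\<^sup>2 + 2 * \<theta> * L\<^sup>2 + 2 * L + 1 + \<omega>\<^sup>2 / 8 * L\<^sup>2)"
proof -
  let ?\<rho> = "2 powr (- \<omega>\<^sup>2 / 4 * L\<^sup>2 + 2 * \<theta> * L\<^sup>2 + 2 * L + 1)"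
  have "measure_pmf.prob (gnp_half n) {E. \<not> small_weight (E \<union> nsets P 2) P} \<le>
      (real m + 1) * (real r + 1) * ?\<rho> / 2 powr (- \<omega>\<^sup>2 / 8 * L\<^sup>2)"
    unfolding small_weight_def not_less
    by (rule prob_boundary_weight[OF P(1), where f = "\<lambda>q. level_weight \<theta> L (min q l)"])
       (use boundary_term_le[OF P(2)] in \<open>auto intro: less_imp_le[OF level_weight_pos]\<close>)
  also have "\<dots> = (real m + 1) * (real r + 1) * (?\<rho> / 2 powr (- \<omega>\<^sup>2 / 8 * L\<^sup>2))"
    by simp
  also have "?\<rho> / 2 powr (- \<omega>\<^sup>2 / 8 * L\<^sup>2) =
      2 powr (- \<omega>\<^sup>2 / 4 * L\<^sup>2 + 2 * \<theta> * L\<^sup>2 + 2 * L + 1 + \<omega>\<^sup>2 / 8 * L\<^sup>2)"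
    unfolding powr_diff[symmetric] by (rule arg_cong[where f = "(powr) 2"]) simp
  also have "(real m + 1) * (real r + 1) * \<dots> \<le> ((2 * L + 2) * (2 * L + 2)) * \<dots>"
    using m_le(2) r_le L_ge by (intro mult_right_mono mult_mono) auto
  finally show ?thesis by (simp add: power2_eq_square)
qed

lemma prob_not_large_degrees:
  "measure_pmf.prob (gnp_half n) {E. \<not> large_degrees E} \<le>
    (L + 1) * 2 powr (L\<^sup>2) * 2 powr (L - 2 powr (\<omega> / 2 * L) / 4)"
proof -
  let ?y = "\<lambda>q. real n / (2 ^ q * (4 * L))"
  let ?\<rho> = "2 powr (L - 2 powr (\<omega> / 2 * L) / 4)"
  have "measure_pmf.prob (gnp_half n) {E. \<not> large_degrees E} \<le> (real l + 1) * real n ^ l * ?\<rho>"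
    unfolding large_degrees_def not_all not_imp not_le
  proof (rule order_trans[OF _ prob_degree_failure[OF n_pos l_le(2), where y = ?y and \<rho> = ?\<rho>]])
    show "measure_pmf.prob (gnp_half n) {E. \<exists>C. C \<subseteq> {..<n} \<and> card C \<le> l \<and> real (card (common_neighbours n E C)) < ?y (card C)}
      \<le> measure_pmf.prob (gnp_half n) {E. \<exists>C\<subseteq>{..<n}. card C \<le> l \<and> real (card (common_neighbours n E C)) < ?y (card C)}"
      by simp
  next
    fix q assume q: "q \<le> l"
    define j where "j = nat \<lceil>?y q\<rceil>"
    define z where "z = real n / 2 ^ q"
    have z: "z = 2 powr (L - real q)"
      by (simp add: z_def n_eq powr_diff powr_realpow)
    have y: "?y q = z / (4 * L)" by (simp add: z_def)
    have zpos: "z > 0" by (simp add: z)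
    have zn: "z \<le> real n" using n_pos by (simp add: z_def field_simps)
    have "z / (4 * L) \<le> z / 4" using L_ge zpos by (intro divide_left_mono) auto
    moreover have j: "real j \<le> z / (4 * L) + 1"
    proof -
      have "z / (4 * L) \<ge> 0" using zpos L_ge by simp
      then show ?thesis unfolding j_def y by linarith
    qed
    ultimately have "real j \<le> real n / 4 + 1" using zn by linarith
    then have qj: "real q + real j \<le> real n / 2"
      using q l_le(1) L_le by linarith
    then have jn: "j \<le> n" "q + j \<le> n" by linarith+
    have "real n ^ j \<le> 2 powr (L * (z / (4 * L) + 1))"
      unfolding n_power using j L_ge by (intro powr_mono mult_left_mono) auto
    also have "L * (z / (4 * L) + 1) = L + z / 4"
      using L_ge by (simp add: field_simps)
    finally have a: "real n ^ j \<le> 2 powr (L + z / 4)" .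
    \<comment> \<open>Removing \<open>q + j\<close> vertices leaves at least half of them;
      \<open>ln 2 < 1\<close> then permits base 2.\<close>
    have "- (real n - real q - real j) / 2 ^ q \<le> - (real n / 2) / 2 ^ q"
      using qj by (intro divide_right_mono) auto
    also have "\<dots> = - (z / 2)" by (simp add: z_def)
    also have "\<dots> \<le> - (z / 2) * ln 2"
      using zpos ln_2_less_1 by simp
    finally have b: "exp (- (real n - real q - real j) / 2 ^ q) \<le> 2 powr (- (z / 2))"
      unfolding powr_def by simp
    have "real n ^ j * exp (- (real n - real q - real j) / 2 ^ q) \<le> 2 powr (L + z / 4) * 2 powr (- (z / 2))"
      using a b by (intro mult_mono) auto
    also have "\<dots> = 2 powr (L - z / 4)"
      by (simp add: powr_add[symmetric])
    also have "\<dots> \<le> ?\<rho>"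
    proof -
      \<comment> \<open>So the bound is doubly exponentially small in \<open>L\<close> and beats the
        number of vertex sets.\<close>
      have "\<omega> / 2 * L \<le> L - real q" using q l_bounds(1) by (simp add: algebra_simps)
      then show ?thesis unfolding z by (intro powr_mono diff_left_mono divide_right_mono) auto
    qed
    finally show "nat \<lceil>?y q\<rceil> \<le> n \<and> q + nat \<lceil>?y q\<rceil> \<le> n \<and>
        real n ^ nat \<lceil>?y q\<rceil> * exp (- (real n - real q - real (nat \<lceil>?y q\<rceil>)) / 2 ^ q) \<le> ?\<rho>"
      using jn unfolding j_def by blast
  qed simp
  also have "\<dots> \<le> (L + 1) * 2 powr (L\<^sup>2) * ?\<rho>"
    unfolding n_power using l_le(1) L_ge
    by (intro mult_right_mono mult_mono powr_mono) (auto simp: power2_eq_square)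
  finally show ?thesis .
qed

lemma prob_bad_le_failure_bound:
  assumes P: "P \<subseteq> {..<n}" "real (card P) \<le> real n powr \<alpha>"
  shows "measure_pmf.prob (gnp_half n) {E. \<not> (large_degrees E \<and> small_weight (E \<union> nsets P 2) P)} \<le> failure_bound \<omega> \<theta> L"
proof -
  have "measure_pmf.prob (gnp_half n) {E. \<not> (large_degrees E \<and> small_weight (E \<union> nsets P 2) P)} \<le>
      measure_pmf.prob (gnp_half n) ({E. \<not> large_degrees E} \<union> {E. \<not> small_weight (E \<union> nsets P 2) P})"
    by (intro measure_pmf.finite_measure_mono) auto
  also have "\<dots> \<le> measure_pmf.prob (gnp_half n) {E. \<not> large_degrees E} +
      measure_pmf.prob (gnp_half n) {E. \<not> small_weight (E \<union> nsets P 2) P}"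
    by (intro measure_Un_le) auto
  also have "\<dots> \<le> failure_bound \<omega> \<theta> L"
    unfolding failure_bound_def by (intro add_mono prob_not_large_degrees prob_not_small_weight P)
  finally show ?thesis .
qed

text \<open>The bound \<open>\<theta> * L\<close> on \<open>\<beta>\<close> is what
  \<open>b \<in> o(log n)\<close> provides for large \<open>n\<close>.\<close>

lemma lipschitz_energy_le:
  assumes h: "one_lipschitz n h" and \<beta>: "\<bar>\<beta>\<bar> \<le> \<theta> * L"
    and q: "q \<le> n" "q' \<le> n" "real q \<le> 2.1 * L" "real q' \<le> 2.1 * L"
  shows "\<bar>\<beta> * (h q - h q')\<bar> \<le> \<theta> * L * \<bar>real q - real q'\<bar>"
proof -
  have "\<bar>h q - h q'\<bar> \<le> \<bar>real q - real q'\<bar>"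
    using h q by (auto simp: one_lipschitz_def L_eq)
  then have "\<bar>\<beta>\<bar> * \<bar>h q - h q'\<bar> \<le> \<theta> * L * \<bar>real q - real q'\<bar>"
    using \<beta> by (intro mult_mono) auto
  then show ?thesis by (simp add: abs_mult)
qed

lemma level_weight_halves:
  assumes "q \<le> l"
  shows "level_weight \<theta> L (Suc q) \<le> level_weight \<theta> L q / 2"
proof -
  have "real q + 1 - (1 - 2 * \<theta>) * L \<le> - 1"
    using assms l_bounds(1) halving by linarith
  then have "2 powr (real q + 1 - (1 - 2 * \<theta>) * L) \<le> 2 powr (- 1)"
    by (intro powr_mono) auto
  from mult_left_mono[OF this less_imp_le[OF level_weight_pos[of \<theta> L q]]]
  show ?thesis unfolding level_weight_Suc by (simp add: powr_minus_divide)
qed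

lemma level_weight_ge: "2 powr (- L * real q) \<le> level_weight \<theta> L q"
proof -
  have "0 \<le> 2 * \<theta> * L * real q + real q * (real q + 1) / 2"
    using \<theta>_pos L_ge by (intro add_nonneg_nonneg) auto
  then show ?thesis
    unfolding level_weight_def by (intro powr_mono) (auto simp: algebra_simps)
qed

text \<open>The degree is at least \<open>2 powr (L - card C) / (4 * L)\<close> and consecutive
  weights have ratio \<open>2 powr (card C - (1 - 2 * \<theta>) * L)\<close>. Their product
  \<open>2 powr (2 * \<theta> * L) / (4 * L)\<close> outweighs the at most \<open>L\<close> removals
  and the acceptance loss by \<open>acceptance\<close>.\<close>

lemma level_weight_balance:
  assumes "large_degrees E" "C \<subseteq> {..<n}" "0 < card C" "card C \<le> l"
  shows "real (card C) * level_weight \<theta> L (card C - 1) \<le>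
    real (card (common_neighbours n E C)) * exp (- \<theta> * L) * level_weight \<theta> L (card C) / 2"
proof -
  define q where "q = card C - 1"
  have q: "card C = Suc q" using assms(3) by (simp add: q_def)
  have qL: "real (Suc q) \<le> L" using assms(4) l_le(1) q by simp
  have nq: "real n / (2 ^ Suc q * (4 * L)) = 2 powr (L - real q - 1) / (4 * L)"
  proof -
    have "real n / 2 ^ Suc q = 2 powr (L - real (Suc q))"
      by (simp only: n_eq powr_diff powr_realpow zero_less_numeral)
    then show ?thesis by (simp add: field_simps)
  qed
  have deg: "2 powr (L - real q - 1) / (4 * L) \<le> real (card (common_neighbours n E C))"
    using assms(1,2,4) unfolding large_degrees_def nq[symmetric] q[symmetric] by blast
  \<comment> \<open>Written so that the numerator is the left side of
    \<open>acceptance\<close>.\<close>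
  have "real (Suc q) \<le> 8 * L\<^sup>2 / (8 * L)"
    using qL L_ge by (simp add: power2_eq_square)
  also have "\<dots> \<le> exp (- \<theta> * L) * 2 powr (2 * \<theta> * L) / (8 * L)"
    using acceptance L_ge by (intro divide_right_mono) auto
  also have "2 powr (2 * \<theta> * L) = 2 powr (L - real q - 1) * 2 powr (real q + 1 - (1 - 2 * \<theta>) * L)"
    unfolding powr_add[symmetric] by (rule arg_cong[where f = "(powr) 2"]) (simp add: algebra_simps)
  also have "exp (- \<theta> * L) * \<dots> / (8 * L) =
      2 powr (L - real q - 1) / (4 * L) * (exp (- \<theta> * L) * 2 powr (real q + 1 - (1 - 2 * \<theta>) * L) / 2)"
    by simp
  also have "\<dots> \<le> real (card (common_neighbours n E C)) * (exp (- \<theta> * L) * 2 powr (real q + 1 - (1 - 2 * \<theta>) * L) / 2)"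
    using deg by (intro mult_right_mono) auto
  finally have "real (Suc q) * level_weight \<theta> L q \<le>
      real (card (common_neighbours n E C)) * (exp (- \<theta> * L) * 2 powr (real q + 1 - (1 - 2 * \<theta>) * L) / 2) * level_weight \<theta> L q"
    using level_weight_pos[of \<theta> L q] by (intro mult_right_mono) auto
  then show ?thesis
    unfolding q level_weight_Suc by (simp add: mult_ac)
qed

text \<open>The budget in units of \<open>\<omega>\<^sup>2 * L\<^sup>2 / 64\<close>: squared time,
  energy and starting weight cost 1 each, the boundary weight gains 8, and \<open>slack\<close>
  bounds the constant by 2.\<close>

lemma total_exponent_le:
  "2 + 2 * (\<omega>\<^sup>2 / 128 * L\<^sup>2) + 4 * \<theta> * L\<^sup>2 + \<omega>\<^sup>2 / 64 * L\<^sup>2 - \<omega>\<^sup>2 / 8 * L\<^sup>2 \<le> - (\<omega>\<^sup>2 / 128) * L\<^sup>2"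
proof -
  have "2 + 2 * (\<omega>\<^sup>2 / 128 * L\<^sup>2) + 4 * \<theta> * L\<^sup>2 + \<omega>\<^sup>2 / 64 * L\<^sup>2 - \<omega>\<^sup>2 / 8 * L\<^sup>2 = 2 - 5 / 64 * (\<omega>\<^sup>2 * L\<^sup>2)"
    by (simp add: \<theta>_eq)
  moreover have "- (\<omega>\<^sup>2 / 128) * L\<^sup>2 = - (1 / 128) * (\<omega>\<^sup>2 * L\<^sup>2)"
    by simp
  ultimately show ?thesis using slack by linarith
qed

text \<open>Here \<open>E'\<close> is the graph before planting: degrees are controlled in
  \<open>E'\<close>, the boundary weight in \<open>E\<close>. A path reaching the target size meets
  the boundary first.\<close>

lemma metropolis_hit_prob_le:
  assumes E': "large_degrees E'" "E' \<subseteq> E" and weight: "small_weight E P"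
    and h: "one_lipschitz n h" and \<beta>: "\<bar>\<beta>\<bar> \<le> \<theta> * L"
    and C: "C \<in> cliques n E" "real (card C) \<le> \<omega>\<^sup>2 / 64 * L"
  shows "measure (metropolis n E h \<beta> C)
      {X. \<exists>t. real t \<le> real n powr (\<omega>\<^sup>2 / 128 * L) \<and> real (card (X t)) \<ge> (1 + \<epsilon>) * L} \<le>
    real n powr (- (\<omega>\<^sup>2 / 128) * L)"
proof -
  define T where "T = nat \<lfloor>real n powr (\<omega>\<^sup>2 / 128 * L)\<rfloor>"
  let ?c = "\<omega>\<^sup>2 / 128 * L\<^sup>2"
  let ?B = "boundary_cliques n E P m r"
  let ?M = "exp (\<theta> * L * (2.1 * L))"
  let ?W = "\<Sum>D\<in>?B. level_weight \<theta> L (min (card D) l)"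
  have \<omega>2: "\<omega>\<^sup>2 \<le> \<omega>" using \<omega>_bounds by (simp add: power2_eq_square mult_le_cancel_right1)
  have \<omega>L: "\<omega>\<^sup>2 * L \<le> \<omega> * L" "\<omega> * L > 0" "\<omega> * L \<le> L" "\<omega> * L \<le> (1 - \<alpha>) * L" "0 < \<epsilon> * L"
    using \<omega>_bounds \<omega>2 L_ge params by (auto intro: mult_right_mono)
  have Cr: "card C < r" and Cm: "card C < m" and Cl: "card C \<le> l" and CL: "real (card C) \<le> L"
  proof -
    have C': "real (card C) \<le> \<omega> * L / 64" using C(2) \<omega>L(1) by simp
    have "(1 - \<alpha>) / 2 * L = ((1 - \<alpha>) * L) / 2" by simp
    then show "card C < r" using C' \<omega>L r_bounds(1) by linarith
    have "(1 + \<epsilon>) * L = L + \<epsilon> * L" by (simp add: algebra_simps)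
    then show "card C < m" using C' \<omega>L m_bounds(1) by linarith
    have "(1 - \<omega> / 2) * L = L - \<omega> * L / 2" by (simp add: algebra_simps)
    then show "card C \<le> l" using C' \<omega>L l_bounds(2) L_ge by linarith
    show "real (card C) \<le> L" using C' \<omega>L by linarith
  qed
  have card_n: "card D \<le> n" if "D \<in> cliques n E" for D
    using card_mono[of "{..<n}" D] that by (simp add: cliques_def)
  have "measure (metropolis n E h \<beta> C)
      {X. \<exists>t. real t \<le> real n powr (\<omega>\<^sup>2 / 128 * L) \<and> real (card (X t)) \<ge> (1 + \<epsilon>) * L} \<le>
    (real T + 1)\<^sup>2 * ?M / level_weight \<theta> L (card C) * ?W"
  proof (rule metropolis_hit_bound[where g = "level_weight \<theta> L", OF n_pos C(1) Cl E'(2) level_weight_pos level_weight_halves])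
    show "0 \<le> exp (- \<theta> * L)" "exp (- \<theta> * L) \<le> 1"
      using \<theta>_pos L_ge by auto
    show "exp (- \<theta> * L) \<le> exp (\<beta> * (h (Suc q) - h q))" if "q \<le> l" "q < n" for q
    proof -
      have "real q + 1 \<le> 2.1 * L" using that l_le(1) L_ge by linarith
      then have "\<bar>\<beta> * (h (Suc q) - h q)\<bar> \<le> \<theta> * L * \<bar>real (Suc q) - real q\<bar>"
        using that by (intro lipschitz_energy_le[OF h \<beta>]) auto
      then show ?thesis by simp
    qed
    show "real (card D) * level_weight \<theta> L (card D - 1) \<le>
        real (card (common_neighbours n E' D)) * exp (- \<theta> * L) * level_weight \<theta> L (card D) / 2"
      if "D \<in> cliques n E" "0 < card D" "card D \<le> l" for D
      using level_weight_balance[OF E'(1) _ that(2,3)] that(1) by (simp add: cliques_def)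
    show "?B \<subseteq> cliques n E" by (auto simp: boundary_cliques_def)
    show "exp (\<beta> * (h (card D) - h (card C))) \<le> ?M" if "D \<in> ?B" for D
    proof -
      have D: "D \<in> cliques n E" "card D \<le> m" using that by (auto simp: boundary_cliques_def)
      then have DL: "real (card D) \<le> 2.1 * L" using m_le(1) by linarith
      then have "\<bar>\<beta> * (h (card D) - h (card C))\<bar> \<le> \<theta> * L * \<bar>real (card D) - real (card C)\<bar>"
        using card_n[OF D(1)] card_n[OF C(1)] CL L_ge by (intro lipschitz_energy_le[OF h \<beta>]) auto
      also have "\<dots> \<le> \<theta> * L * (2.1 * L)"
      proof (rule mult_left_mono)
        show "\<bar>real (card D) - real (card C)\<bar> \<le> 2.1 * L" using DL CL L_ge by linarith
      qed (use \<theta>_pos L_ge in simp)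
      finally show ?thesis by simp
    qed
    show "\<exists>t\<le>T. X t \<in> ?B"
      if X: "X 0 = C" "\<And>t. X t \<in> cliques n E \<and> X (Suc t) \<in> set_pmf (metropolis_step n E h \<beta> (X t))"
        "X \<in> {X. \<exists>t. real t \<le> real n powr (\<omega>\<^sup>2 / 128 * L) \<and> real (card (X t)) \<ge> (1 + \<epsilon>) * L}" for X
    proof -
      obtain t where t: "real t \<le> real n powr (\<omega>\<^sup>2 / 128 * L)" "real (card (X t)) \<ge> (1 + \<epsilon>) * L"
        using X(3) by blast
      have "t \<le> T" using t(1) unfolding T_def by linarith
      have "m \<le> card (X t)" using t(2) unfolding m_eq by linarith
      have "card (X 0 \<inter> P) \<le> card (X 0)"
        using finite_clique[OF C(1)] X(1) by (intro card_mono) auto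
      then have "card (X 0) < m" "card (X 0 \<inter> P) < r" using Cm Cr X(1) by auto
      from exit_through_boundary[OF n_pos X(2) this \<open>m \<le> card (X t)\<close>] \<open>t \<le> T\<close>
      show ?thesis using order_trans by blast
    qed
  qed
  \<comment> \<open>The factors account in turn for time, energy difference, starting weight and
    boundary weight.\<close>
  also have "\<dots> \<le> (2 * 2 powr ?c)\<^sup>2 * 2 powr (4 * \<theta> * L\<^sup>2) / 2 powr (- L * real (card C)) * 2 powr (- \<omega>\<^sup>2 / 8 * L\<^sup>2)"
  proof (intro mult_mono frac_le power_mono)
    have e: "real n powr (\<omega>\<^sup>2 / 128 * L) = 2 powr ?c"
      unfolding n_powr by (rule arg_cong[where f = "(powr) 2"]) (simp add: power2_eq_square)
    have "2 powr ?c \<ge> 2 powr 0" by (intro powr_mono) auto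
    then have "1 \<le> 2 powr ?c" by simp
    moreover from this have "real T \<le> 2 powr ?c"
      unfolding T_def e by linarith
    ultimately show "real T + 1 \<le> 2 * 2 powr ?c" by linarith
    \<comment> \<open>Change from base e to base 2, using \<open>2.1 \<le> 4 * ln 2\<close>.\<close>
    have "\<theta> * L * (2.1 * L) = 2.1 * (\<theta> * L\<^sup>2)" by (simp add: power2_eq_square)
    also have "\<dots> \<le> 4 * (\<theta> * L\<^sup>2) * ln 2"
    proof -
      have "0 \<le> \<theta> * L\<^sup>2" using \<theta>_pos by simp
      moreover have "ln 2 \<ge> (0.6 :: real)" using ln2_ge_two_thirds by simp
      ultimately have "(\<theta> * L\<^sup>2) * 0.6 \<le> (\<theta> * L\<^sup>2) * ln 2" by (intro mult_left_mono)
      then show ?thesis using \<open>0 \<le> \<theta> * L\<^sup>2\<close> by linarith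
    qed
    finally show "?M \<le> 2 powr (4 * \<theta> * L\<^sup>2)" by (simp add: powr_def mult_ac)
    show "2 powr (- L * real (card C)) \<le> level_weight \<theta> L (card C)" by (rule level_weight_ge)
    show "?W \<le> 2 powr (- \<omega>\<^sup>2 / 8 * L\<^sup>2)" using weight by (simp add: small_weight_def)
    show "0 \<le> ?W" by (intro sum_nonneg less_imp_le level_weight_pos)
  qed auto
  also have "\<dots> = 2 powr (2 + 2 * ?c + 4 * \<theta> * L\<^sup>2 + L * real (card C) - \<omega>\<^sup>2 / 8 * L\<^sup>2)"
  proof -
    have "(2 * 2 powr ?c)\<^sup>2 = 2 powr (2 + 2 * ?c)"
      by (simp add: powr_add power_mult_distrib powr_realpow[symmetric] powr_powr mult.commute)
    then show ?thesis
      by (simp only: powr_add[symmetric] powr_diff[symmetric]) (rule arg_cong[where f = "(powr) 2"], simp)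
  qed
  also have "\<dots> \<le> 2 powr (- (\<omega>\<^sup>2 / 128) * L\<^sup>2)"
  proof -
    have "L * real (card C) \<le> L * (\<omega>\<^sup>2 / 64 * L)" using C(2) L_ge by (intro mult_left_mono) auto
    also have "\<dots> = \<omega>\<^sup>2 / 64 * L\<^sup>2" by (simp add: power2_eq_square)
    finally show ?thesis using total_exponent_le by (intro powr_mono) linarith+
  qed
  also have "\<dots> = real n powr (- (\<omega>\<^sup>2 / 128) * L)"
    unfolding n_powr by (rule arg_cong[where f = "(powr) 2"]) (simp add: power2_eq_square)
  finally show ?thesis .
qed

lemma metropolis_escape_prob_ge:
  assumes E': "large_degrees E'" "E' \<subseteq> E" and weight: "small_weight E P"
    and h: "one_lipschitz n h" and \<beta>: "\<bar>\<beta>\<bar> \<le> \<theta> * L"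
  shows "measure (metropolis n E h \<beta> {})
      {X. \<forall>t. real (card (X t)) \<ge> (1 + \<epsilon>) * L \<longrightarrow> real t \<ge> real n powr (\<omega>\<^sup>2 / 128 * L)} \<ge>
    1 - real n powr (- (\<omega>\<^sup>2 / 128) * L)"
proof -
  interpret finite_markov_chain "metropolis_step n E h \<beta>" "cliques n E" "{}"
    by (rule finite_markov_chain_metropolis[OF n_pos empty_in_cliques])
  let ?G = "{X. \<forall>t. real (card (X t)) \<ge> (1 + \<epsilon>) * L \<longrightarrow> real t \<ge> real n powr (\<omega>\<^sup>2 / 128 * L)}"
  let ?H = "{X. \<exists>t. real t \<le> real n powr (\<omega>\<^sup>2 / 128 * L) \<and> real (card (X t)) \<ge> (1 + \<epsilon>) * L}"
  have ev: "?G \<in> events" "?H \<in> events"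
  proof -
    have "{X \<in> space (markov_chain (metropolis_step n E h \<beta>) {}).
        \<forall>t. real (card (X t)) \<ge> (1 + \<epsilon>) * L \<longrightarrow> real t \<ge> real n powr (\<omega>\<^sup>2 / 128 * L)} \<in> events"
      "{X \<in> space (markov_chain (metropolis_step n E h \<beta>) {}).
        \<exists>t. real t \<le> real n powr (\<omega>\<^sup>2 / 128 * L) \<and> real (card (X t)) \<ge> (1 + \<epsilon>) * L} \<in> events"
      by measurable
    then show "?G \<in> events" "?H \<in> events" by simp_all
  qed
  \<comment> \<open>The events may overlap, in a first visit exactly at the threshold time, but they
    cover all paths, so subadditivity suffices.\<close>
  have "?G \<union> ?H = space (markov_chain (metropolis_step n E h \<beta>) {})"
    using linear by fastforce
  then have "1 = prob (?G \<union> ?H)"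
    using prob_space by simp
  also have "\<dots> \<le> prob ?G + prob ?H"
    using ev by (intro measure_Un_le)
  also have "prob ?H \<le> real n powr (- (\<omega>\<^sup>2 / 128) * L)"
    using metropolis_hit_prob_le[OF E' weight h \<beta> empty_in_cliques] L_ge by (simp add: metropolis_def)
  finally show ?thesis by (simp add: metropolis_def)
qed

end

section \<open>Asymptotics in \<open>n\<close> and conclusion\<close>

lemma failure_bound_tendsto_zero:
  fixes \<omega> :: real
  assumes "0 < \<omega>"
  shows "(failure_bound \<omega> (\<omega>\<^sup>2 / 256) \<longlongrightarrow> 0) at_top"
proof -
  have "((\<lambda>L. (L + 1) * 2 powr (L\<^sup>2) * 2 powr (L - 2 powr (\<omega> / 2 * L) / 4)) \<longlongrightarrow> 0) at_top"
    using assms by real_asymp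
  moreover have "((\<lambda>L. (2 * L + 2)\<^sup>2 *
      2 powr (- \<omega>\<^sup>2 / 4 * L\<^sup>2 + 2 * (\<omega>\<^sup>2 / 256) * L\<^sup>2 + 2 * L + 1 + \<omega>\<^sup>2 / 8 * L\<^sup>2)) \<longlongrightarrow> 0) at_top"
  proof -
    \<comment> \<open>The net quadratic coefficient: 1/4 - 2/256 - 1/8 = 15/128.\<close>
    define x where "x = \<omega>\<^sup>2 * (15 / 128)"
    have "x > 0" using assms by (simp add: x_def)
    then have "((\<lambda>L. (2 * L + 2)\<^sup>2 * 2 powr (2 * L + 1 - x * L\<^sup>2)) \<longlongrightarrow> 0) at_top"
      by real_asymp
    then show ?thesis by (simp add: x_def algebra_simps)
  qed
  ultimately show ?thesis
    unfolding failure_bound_def[abs_def] by (intro tendsto_add_zero)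
qed

text \<open>The conditions on \<open>L\<close> alone hold for large real \<open>L\<close> and are
  pulled back along \<open>log 2 n\<close>.\<close>

lemma eventually_planted_instance:
  fixes \<alpha> \<epsilon> :: real
  assumes "0 \<le> \<alpha>" "\<alpha> < 1" "0 < \<epsilon>" "\<epsilon> < 1" and \<omega>: "\<omega> = min \<epsilon> (1 - \<alpha>)"
  shows "eventually (\<lambda>n. planted_instance \<alpha> \<epsilon> \<omega> (\<omega>\<^sup>2 / 256) (log 2 (real n)) n
    (nat \<lfloor>(1 - \<omega> / 2) * log 2 (real n)\<rfloor>) (nat \<lceil>(1 + \<epsilon>) * log 2 (real n)\<rceil>)
    (nat \<lceil>(1 - \<alpha>) / 2 * log 2 (real n)\<rceil>)) sequentially"
proof -
  define \<theta> where "\<theta> = \<omega>\<^sup>2 / 256"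
  have \<omega>': "0 < \<omega>" "\<omega> < 1" using assms by auto
  then have "\<omega> * \<omega> \<le> 1 * \<omega>" by (intro mult_right_mono) auto
  then have \<theta>: "\<theta> > 0" "2 * \<theta> < \<omega> / 2"
    using \<omega>' by (auto simp: \<theta>_def power2_eq_square)
  have lim: "filterlim (\<lambda>n. log 2 (real n)) at_top sequentially"
    by real_asymp
  have "eventually (\<lambda>L. 8 * L\<^sup>2 \<le> exp (- \<theta> * L) * 2 powr (2 * \<theta> * L)) at_top"
  proof -
    \<comment> \<open>The rate is positive because \<open>2 * ln 2 > 1\<close>: in base 2 the factor
      \<open>n powr (2 * \<theta>)\<close> beats the acceptance loss
      \<open>exp (- \<theta> * L)\<close>.\<close>
    define x where "x = \<theta> * (2 * ln 2 - 1)"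
    have "x > 0" using \<theta> ln2_ge_two_thirds by (simp add: x_def)
    then have "eventually (\<lambda>L. 8 * L\<^sup>2 \<le> exp (x * L)) at_top"
      by real_asymp
    moreover have "exp (x * L) = exp (- \<theta> * L) * 2 powr (2 * \<theta> * L)" for L
      by (simp add: x_def powr_def exp_add[symmetric] algebra_simps)
    ultimately show ?thesis by simp
  qed
  moreover have "eventually (\<lambda>L. (1 - \<omega> / 2) * L + 2 \<le> (1 - 2 * \<theta>) * L) at_top"
  proof -
    define x where "x = \<omega> / 2 - 2 * \<theta>"
    have "x > 0" using \<theta> by (simp add: x_def)
    then have "eventually (\<lambda>L. 2 \<le> x * L) at_top" by real_asymp
    then show ?thesis by eventually_elim (simp add: x_def algebra_simps)
  qed
  moreover have "eventually (\<lambda>L. 2 \<le> \<omega>\<^sup>2 * L\<^sup>2 / 32) at_top"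
    using \<omega>' by real_asymp
  ultimately have "eventually (\<lambda>L. 10 \<le> L \<and> 8 * L\<^sup>2 \<le> exp (- \<theta> * L) * 2 powr (2 * \<theta> * L) \<and>
      (1 - \<omega> / 2) * L + 2 \<le> (1 - 2 * \<theta>) * L \<and> 2 \<le> \<omega>\<^sup>2 * L\<^sup>2 / 32) at_top"
    using eventually_ge_at_top[of "10 :: real"] by eventually_elim simp
  from eventually_compose_filterlim[OF this lim]
  have "eventually (\<lambda>n. 10 \<le> log 2 (real n) \<and>
      8 * (log 2 (real n))\<^sup>2 \<le> exp (- \<theta> * log 2 (real n)) * 2 powr (2 * \<theta> * log 2 (real n)) \<and>
      (1 - \<omega> / 2) * log 2 (real n) + 2 \<le> (1 - 2 * \<theta>) * log 2 (real n) \<and>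
      2 \<le> \<omega>\<^sup>2 * (log 2 (real n))\<^sup>2 / 32) sequentially" .
  moreover have "eventually (\<lambda>n. log 2 (real n) + 1 \<le> real n / 4) sequentially"
    by real_asymp
  ultimately show ?thesis
    by eventually_elim (unfold_locales, use assms in \<open>auto simp: \<theta>_def\<close>)
qed

theorem theorem7p6:
  fixes \<alpha> \<epsilon> :: real
  assumes "0 \<le> \<alpha>" "\<alpha> < 1" and "0 < \<epsilon>" "\<epsilon> < 1"
  shows "\<exists>\<xi>>0. \<exists>c>0. \<exists>c\<^sub>1>0. \<exists>c\<^sub>2>0.
    \<forall>b :: nat \<Rightarrow> real. (\<forall>n. 0 \<le> b n) \<and> b \<in> o(\<lambda>n. log 2 (real n)) \<longrightarrow>
    (\<lambda>n. \<P>(E in planted_clique n (nat \<lfloor>real n powr \<alpha>\<rfloor>).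
       \<forall>h :: nat \<Rightarrow> real. \<forall>\<beta> :: real. one_lipschitz n h \<and> h 0 = 0 \<and> \<bar>\<beta>\<bar> \<le> b n \<longrightarrow>
         (\<forall>C\<in>cliques n E. real (card C) \<le> \<xi> * log 2 (real n) \<longrightarrow>
            \<P>(X in metropolis n E h \<beta> C.
               \<exists>t. real t \<le> real n powr (c * log 2 (real n)) \<and>
                   real (card (X t)) \<ge> (1 + \<epsilon>) * log 2 (real n))
              \<le> real n powr (- c * log 2 (real n))) \<and>
         \<P>(X in metropolis n E h \<beta> {}.
            \<forall>t. real (card (X t)) \<ge> (1 + \<epsilon>) * log 2 (real n) \<longrightarrow>
                real t \<ge> real n powr (c\<^sub>1 * log 2 (real n)))
           \<ge> 1 - real n powr (- c\<^sub>2 * log 2 (real n))))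
      \<longlonglongrightarrow> 1"
proof -
  define \<omega> where "\<omega> = min \<epsilon> (1 - \<alpha>)"
  have \<omega>: "\<omega> > 0" using assms by (simp add: \<omega>_def)
  define \<xi> where "\<xi> = \<omega>\<^sup>2 / 64"
  define c where "c = \<omega>\<^sup>2 / 128"
  \<comment> \<open>One constant \<open>c\<close> also serves as both constants of the claim about
    the empty clique.\<close>
  define Q where "Q b n E \<longleftrightarrow> (\<forall>h :: nat \<Rightarrow> real. \<forall>\<beta> :: real. one_lipschitz n h \<and> h 0 = 0 \<and> \<bar>\<beta>\<bar> \<le> b n \<longrightarrow>
         (\<forall>C\<in>cliques n E. real (card C) \<le> \<xi> * log 2 (real n) \<longrightarrow>
            \<P>(X in metropolis n E h \<beta> C.
               \<exists>t. real t \<le> real n powr (c * log 2 (real n)) \<and>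
                   real (card (X t)) \<ge> (1 + \<epsilon>) * log 2 (real n))
              \<le> real n powr (- c * log 2 (real n))) \<and>
         \<P>(X in metropolis n E h \<beta> {}.
            \<forall>t. real (card (X t)) \<ge> (1 + \<epsilon>) * log 2 (real n) \<longrightarrow>
                real t \<ge> real n powr (c * log 2 (real n)))
           \<ge> 1 - real n powr (- c * log 2 (real n)))" for b :: "nat \<Rightarrow> real" and n E
  let ?fail = "\<lambda>n. failure_bound \<omega> (\<omega>\<^sup>2 / 256) (log 2 (real n))"
  have main: "(\<lambda>n. \<P>(E in planted_clique n (nat \<lfloor>real n powr \<alpha>\<rfloor>). Q b n E)) \<longlonglongrightarrow> 1"
    if b: "\<forall>n. 0 \<le> b n" "b \<in> o(\<lambda>n. log 2 (real n))" for b
  proof (rule tendsto_sandwich[where f = "\<lambda>n. 1 - ?fail n" and h = "\<lambda>_. 1"])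
    \<comment> \<open>The only use of \<open>b = o(log n)\<close>: eventually \<open>b n\<close> is
      at most \<open>\<theta> * L\<close>.\<close>
    have "eventually (\<lambda>n. norm (b n) \<le> \<omega>\<^sup>2 / 256 * norm (log 2 (real n))) sequentially"
      using landau_o.smallD[OF b(2), of "\<omega>\<^sup>2 / 256"] \<omega> by simp
    with eventually_planted_instance[OF assms \<omega>_def]
    show "eventually (\<lambda>n. 1 - ?fail n \<le> \<P>(E in planted_clique n (nat \<lfloor>real n powr \<alpha>\<rfloor>). Q b n E)) sequentially"
    proof eventually_elim
      case (elim n)
      define L where "L = log 2 (real n)"
      interpret planted_instance \<alpha> \<epsilon> \<omega> "\<omega>\<^sup>2 / 256" L n
        "nat \<lfloor>(1 - \<omega> / 2) * L\<rfloor>" "nat \<lceil>(1 + \<epsilon>) * L\<rceil>" "nat \<lceil>(1 - \<alpha>) / 2 * L\<rceil>"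
        using elim(1) unfolding L_def .
      have bn: "b n \<le> \<omega>\<^sup>2 / 256 * L"
        using elim(2) b(1) L_ge by (simp add: L_def)
      let ?k = "nat \<lfloor>real n powr \<alpha>\<rfloor>"
      have k: "real ?k \<le> real n powr \<alpha>" by simp
      have "real n powr \<alpha> \<le> real n powr 1"
        using n_pos params by (intro powr_mono) auto
      then have "real n powr \<alpha> \<le> real n" using n_pos by simp
      then have "?k \<le> n" using k by (meson of_nat_le_iff order_trans)
      have "measure_pmf.prob (planted_clique n ?k) {E. Q b n E} \<ge> 1 - failure_bound \<omega> (\<omega>\<^sup>2 / 256) L"
      proof (rule measure_planted_clique_ge[OF \<open>?k \<le> n\<close>])
        fix P assume P: "P \<subseteq> {..<n}" "card P = ?k"
        have "Q b n (E \<union> nsets P 2)"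
          if E: "large_degrees E" "small_weight (E \<union> nsets P 2) P" for E
          unfolding Q_def L_def[symmetric] \<xi>_def c_def
        proof (intro allI impI, elim conjE, intro conjI ballI impI)
          fix h :: "nat \<Rightarrow> real" and \<beta> :: real
          assume h: "one_lipschitz n h" and "\<bar>\<beta>\<bar> \<le> b n"
          then have \<beta>: "\<bar>\<beta>\<bar> \<le> \<omega>\<^sup>2 / 256 * L" using bn by simp
          have sp: "space (metropolis n (E \<union> nsets P 2) h \<beta> C) = UNIV" for C
            by (simp add: metropolis_def)
          show "\<P>(X in metropolis n (E \<union> nsets P 2) h \<beta> C.
              \<exists>t. real t \<le> real n powr (\<omega>\<^sup>2 / 128 * L) \<and> real (card (X t)) \<ge> (1 + \<epsilon>) * L)
            \<le> real n powr (- (\<omega>\<^sup>2 / 128) * L)"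
            if "C \<in> cliques n (E \<union> nsets P 2)" "real (card C) \<le> \<omega>\<^sup>2 / 64 * L" for C
            using metropolis_hit_prob_le[OF E(1) _ E(2) h \<beta> that] by (simp add: sp)
          show "\<P>(X in metropolis n (E \<union> nsets P 2) h \<beta> {}.
              \<forall>t. real (card (X t)) \<ge> (1 + \<epsilon>) * L \<longrightarrow> real t \<ge> real n powr (\<omega>\<^sup>2 / 128 * L))
            \<ge> 1 - real n powr (- (\<omega>\<^sup>2 / 128) * L)"
            using metropolis_escape_prob_ge[OF E(1) _ E(2) h \<beta>] by (simp add: sp)
        qed
        then have "measure_pmf.prob (gnp_half n) {E. \<not> Q b n (E \<union> nsets P 2)} \<le>
            measure_pmf.prob (gnp_half n) {E. \<not> (large_degrees E \<and> small_weight (E \<union> nsets P 2) P)}"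
          by (intro measure_pmf.finite_measure_mono) auto
        also have "\<dots> \<le> failure_bound \<omega> (\<omega>\<^sup>2 / 256) L"
          using P k by (intro prob_bad_le_failure_bound) auto
        finally show "measure_pmf.prob (gnp_half n) {E. \<not> Q b n (E \<union> nsets P 2)} \<le> failure_bound \<omega> (\<omega>\<^sup>2 / 256) L" .
      qed
      then show ?case by (simp add: L_def)
    qed
    have "?fail \<longlonglongrightarrow> 0"
      by (rule filterlim_compose[OF failure_bound_tendsto_zero[OF \<omega>]]) real_asymp
    from tendsto_diff[OF tendsto_const this] show "(\<lambda>n. 1 - ?fail n) \<longlonglongrightarrow> 1" by simp
  qed (auto intro: always_eventually measure_pmf.prob_le_1)
  have "\<xi> > 0" "c > 0" using \<omega> by (simp_all add: \<xi>_def c_def)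
  then show ?thesis
    using main unfolding Q_def by blast
qed

end
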